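(* Assume: (1) the equilibrium $\bm{0}$ is uniformly locally exponentially stable (in the sense given in the context); (2) $B(\bm{0},R)=\{\bm{x}\in\mathbb{R}^n\mid h_0(\bm{x})\le R\}$ with $h_0(\bm{x})=\sum_{i=1}^n x_i^2$ and $R>0$ a constant such that $\Omega(X)\subset B(\bm{0},R)$, where $\Omega(X)=\{\bm{x}\in\mathbb{R}^n\mid \bm{x}=\bm{f}(\bm{x}_0,\bm{d}),\ \bm{x}_0\in X,\ \bm{d}\in D\}\cup X$; and $X_{\infty}=\{\bm{x}\in\mathbb{R}^n\mid h_{\infty}(\bm{x})<1\}$, with $h_{\infty}\in\mathbb{R}[\bm{x}]$, is a robust region of attraction with $\bm{0}\in X_{\infty}^{\circ}$; (3) one of the polynomials $h_i^D$ defining $D$ equals $\|\bm{d}\|^2-R_D$ for some constant $R_D\ge0$. Then there exists a sequence $(u_{k_i})_{i=0}^{\infty}$ such that $u_{k_i}$ converges from above to $v$ uniformly over $B(\bm{0},R)$ as $i\to\infty$, where $u_{k_i}\in\mathbb{R}_{k_i}[\bm{x}]$ denotes the $u$-component of a solution to the sum-of-squares program (SOS) with $k=k_i$ given in the context, and $v$ is the continuous and bounded solution to the Bellman equation given in the context.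
   Context: $\mathbb{N}$ is the set of non-negative integers, $\|\cdot\|$ the Euclidean norm, $B(\bm{0},r)=\{\bm{x}\in\mathbb{R}^n\mid \|\bm{x}\|^2\le r\}$ for $r>0$; $\mathbb{R}_k[\bm{x}]$ is the space of real polynomials in $\bm{x}$ of total degree $\le k$; $\Delta^\circ$ is the interior of $\Delta$. "Converges from above" means $u_{k_i}\ge v$ on $B(\bm{0},R)$ for all $i$. System: $\bm{x}(k+1)=\bm{f}(\bm{x}(k),\bm{d}(k))$, $k\in\mathbb{N}$, where $\bm{f}$ is an $\mathbb{R}^n$-valued map with components in $\mathbb{R}[\bm{x},\bm{d}]$ ($\bm{x}\in\mathbb{R}^n$, $\bm{d}\in\mathbb{R}^m$), $D=\{\bm{d}\in\mathbb{R}^m\mid h_i^D(\bm{d})\le 0,\ i=1,\ldots,m_d\}$ is compact with $h_i^D\in\mathbb{R}[\bm{d}]$, and $\bm{f}(\bm{0},\bm{d})=\bm{0}$ for all $\bm{d}\in D$. A perturbation input policy is a function $\pi:\mathbb{N}\to D$; $\mathcal{D}$ is the set of all of them. The trajectory from $\bm{x}_0$ under $\pi$ is $\bm{\phi}_{\bm{x}_0}^{\pi}(0)=\bm{x}_0$, $\bm{\phi}_{\bm{x}_0}^{\pi}(k+1)=\bm{f}(\bm{\phi}_{\bm{x}_0}^{\pi}(k),\pi(k))$. State constraint set: $X=\{\bm{x}\in\mathbb{R}^n\mid h_i^X(\bm{x})<1,\ i=1,\ldots,n_X\}$ is bounded and open, with $h_i^X\in\mathbb{R}[\bm{x}]$,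 $h_i^X(\bm{x})>0$ for $\bm{x}\ne\bm{0}$ and $h_i^X(\bm{0})=0$. Uniform local exponential stability: there exist constants $M>0$, $r>0$, $0<\lambda<1$ with $B(\bm{0},r)\subset X$ and $\|\bm{\phi}_{\bm{x}_0}^{\pi}(k)\|\le\lambda^kM\|\bm{x}_0\|$ for all $\bm{x}_0\in B(\bm{0},r)$, $\pi\in\mathcal{D}$, $k\in\mathbb{N}$. Maximal robust region of attraction: $\mathcal{R}=\{\bm{x}_0\mid \bm{\phi}_{\bm{x}_0}^{\pi}(k)\in X\ \forall k\in\mathbb{N},\forall\pi\in\mathcal{D},\ \text{and}\ \lim_{k\to\infty}\bm{\phi}_{\bm{x}_0}^{\pi}(k)=\bm{0}\ \forall\pi\in\mathcal{D}\}$. A robust region of attraction is any subset of $\mathcal{R}$. $g\in\mathbb{R}[\bm{x}]$ is a fixed non-negative polynomial with $g(\bm{x})=0$ iff $\bm{x}=\bm{0}$; $l(x)=x$ for $x\ge0$ and $l(x)=0$ otherwise. $v:\mathbb{R}^n\to[0,1]$ is the unique bounded and continuous solution to $$\min\Big\{\inf_{\bm{d}\in D}\{v(\bm{x})-v(\bm{f}(\bm{x},\bm{d}))-g(\bm{x})(1-v(\bm{x}))\},\ v(\bm{x})-1+\min_{1\le j\le n_X} l(1-h_j^X(\bm{x}))\Big\}=0\ \ \forall\bm{x}\in\mathbb{R}^n,\qquad v(\bm{0})=0.$$ Program (SOS): minimize $\int_{B(\bm{0},R)}u\,d\bm{x}-\int_{X_\infty}u\,d\bm{x}$ over $u\in\mathbb{R}_k[\bm{x}]$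 and sum-of-squares polynomials $s_0,s_1,s_2,s_{3,i}\in\mathbb{R}[\bm{x},\bm{d}]$ ($i=1,\ldots,m_d$) and $s_{4,j},\ldots,s_{8,j},s_{9,l,j}\in\mathbb{R}[\bm{x}]$ ($j,l=1,\ldots,n_X$), subject to the polynomial identities, for $j=1,\ldots,n_X$, $$u(\bm{x})-u(\bm{f}(\bm{x},\bm{d}))-g(\bm{x})(1-u(\bm{x}))=s_0+s_1(R-h_0)+s_2(h_\infty-1)-\sum_{i=1}^{m_d}s_{3,i}h_i^D,$$ $$u-1=s_{4,j}+s_{5,j}(R-h_0)+s_{6,j}(h_j^X-1),$$ $$u-h_j^X=s_{7,j}+s_{8,j}(R-h_0)+\sum_{l=1}^{n_X}s_{9,l,j}(1-h_l^X).$$ A solution to (SOS) means a feasible tuple: $u\in\mathbb{R}_k[\bm{x}]$ together with sum-of-squares polynomials $s_0,s_1,s_2,s_{3,i}\in\mathbb{R}[\bm{x},\bm{d}]$ ($i=1,\ldots,m_d$) and $s_{4,j},\ldots,s_{8,j},s_{9,l,j}\in\mathbb{R}[\bm{x}]$ ($j,l=1,\ldots,n_X$) for which all these identities hold. *)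

theory Defs
  imports "HOL-Analysis.Analysis"
begin

text \<open>
  Real polynomials are represented by the functions they induce, which is faithful because the
  reals are an infinite field: a polynomial identity is an identity of functions. Polynomials of
  unrestricted degree, in \<open>x\<close> or jointly in \<open>(x, d)\<close>, are the
  \<^const>\<open>real_polynomial_function\<close>s on \<open>real^'n\<close> or \<open>(real^'n) \<times> (real^'m)\<close>.
\<close>

definition polys_upto :: "nat \<Rightarrow> (real^'n \<Rightarrow> real) set" where
  "polys_upto k =
    {p. \<exists>c. p = (\<lambda>x. \<Sum>\<alpha>\<in>{\<alpha> :: 'n \<Rightarrow> nat. (\<Sum>i\<in>UNIV. \<alpha> i) \<le> k}. c \<alpha> * (\<Prod>i\<in>UNIV. (x $ i) ^ \<alpha> i))}"

lemma finite_multiindices: "finite {\<alpha> :: 'n::finite \<Rightarrow> nat. (\<Sum>i\<in>UNIV. \<alpha> i) \<le> k}"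
proof (rule finite_subset)
  show "{\<alpha> :: 'n \<Rightarrow> nat. (\<Sum>i\<in>UNIV. \<alpha> i) \<le> k} \<subseteq> PiE UNIV (\<lambda>_. {..k})"
  proof
    fix \<alpha> :: "'n \<Rightarrow> nat" assume \<alpha>: "\<alpha> \<in> {\<alpha>. (\<Sum>i\<in>UNIV. \<alpha> i) \<le> k}"
    have "\<alpha> i \<le> k" for i
      using member_le_sum[of i UNIV \<alpha>] \<alpha> by simp
    then show "\<alpha> \<in> PiE UNIV (\<lambda>_. {..k})" by (auto simp: PiE_iff)
  qed
qed (auto intro: finite_PiE)

lemma polys_upto_mono:
  assumes "p \<in> polys_upto k" "k \<le> l" shows "p \<in> polys_upto l"
proof -
  obtain c where c: "p = (\<lambda>x. \<Sum>\<alpha>\<in>{\<alpha> :: 'a \<Rightarrow> nat. (\<Sum>i\<in>UNIV. \<alpha> i) \<le> k}. c \<alpha> * (\<Prod>i\<in>UNIV. (x $ i) ^ \<alpha> i))"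
    using assms(1) by (auto simp: polys_upto_def)
  have "p = (\<lambda>x. \<Sum>\<alpha>\<in>{\<alpha> :: 'a \<Rightarrow> nat. (\<Sum>i\<in>UNIV. \<alpha> i) \<le> l}.
      (if (\<Sum>i\<in>UNIV. \<alpha> i) \<le> k then c \<alpha> else 0) * (\<Prod>i\<in>UNIV. (x $ i) ^ \<alpha> i))"
    unfolding c using assms(2)
    by (intro ext sum.mono_neutral_cong_left) (auto simp: finite_multiindices)
  then show ?thesis unfolding polys_upto_def mem_Collect_eq
    by (rule exI[where x = "\<lambda>\<alpha>. if (\<Sum>i\<in>UNIV. \<alpha> i) \<le> k then c \<alpha> else 0"])
qed

lemma polys_upto_add:
  assumes "p \<in> polys_upto k" "q \<in> polys_upto k" shows "(\<lambda>x. p x + q x) \<in> polys_upto k"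
proof -
  obtain c d where "p = (\<lambda>x. \<Sum>\<alpha>\<in>{\<alpha> :: 'a \<Rightarrow> nat. (\<Sum>i\<in>UNIV. \<alpha> i) \<le> k}. c \<alpha> * (\<Prod>i\<in>UNIV. (x $ i) ^ \<alpha> i))"
    "q = (\<lambda>x. \<Sum>\<alpha>\<in>{\<alpha> :: 'a \<Rightarrow> nat. (\<Sum>i\<in>UNIV. \<alpha> i) \<le> k}. d \<alpha> * (\<Prod>i\<in>UNIV. (x $ i) ^ \<alpha> i))"
    using assms by (auto simp: polys_upto_def)
  then have "(\<lambda>x. p x + q x) = (\<lambda>x. \<Sum>\<alpha>\<in>{\<alpha> :: 'a \<Rightarrow> nat. (\<Sum>i\<in>UNIV. \<alpha> i) \<le> k}.
      (c \<alpha> + d \<alpha>) * (\<Prod>i\<in>UNIV. (x $ i) ^ \<alpha> i))"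
    by (simp add: sum.distrib distrib_right)
  then show ?thesis unfolding polys_upto_def mem_Collect_eq by (rule exI[where x = "\<lambda>\<alpha>. c \<alpha> + d \<alpha>"])
qed

lemma polys_upto_monomial:
  fixes \<beta> :: "'n::finite \<Rightarrow> nat"
  assumes "(\<Sum>i\<in>UNIV. \<beta> i) \<le> k"
  shows "(\<lambda>x. a * (\<Prod>i\<in>UNIV. (x $ i) ^ \<beta> i)) \<in> polys_upto k"
proof -
  have "(\<Sum>\<alpha>\<in>{\<alpha> :: 'n \<Rightarrow> nat. (\<Sum>i\<in>UNIV. \<alpha> i) \<le> k}.
      (if \<alpha> = \<beta> then a else 0) * (\<Prod>i\<in>UNIV. (x $ i) ^ \<alpha> i)) = a * (\<Prod>i\<in>UNIV. (x $ i) ^ \<beta> i)"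
    for x :: "real^'n"
    using assms finite_multiindices[of k]
    by (subst sum.mono_neutral_cong_right[where S = "{\<beta>}"]) auto
  then show ?thesis unfolding polys_upto_def mem_Collect_eq
    by (intro exI[where x = "\<lambda>\<alpha>. if \<alpha> = \<beta> then a else 0"]) simp
qed

lemma polys_upto_sum:
  assumes "finite A" "\<And>i. i \<in> A \<Longrightarrow> p i \<in> polys_upto k"
  shows "(\<lambda>x. \<Sum>i\<in>A. p i x) \<in> polys_upto k"
  using assms
proof (induction A rule: finite_induct)
  case empty
  then show ?case using polys_upto_monomial[of "\<lambda>_. 0" k 0] by simp
next
  case (insert i A)
  then show ?case by (simp add: polys_upto_add)
qed

lemma polys_upto_mult:
  assumes "p \<in> polys_upto k" "q \<in> polys_upto l" shows "(\<lambda>x. p x * q x) \<in> polys_upto (k + l)"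
proof -
  obtain c d where "p = (\<lambda>x. \<Sum>\<alpha>\<in>{\<alpha> :: 'a \<Rightarrow> nat. (\<Sum>i\<in>UNIV. \<alpha> i) \<le> k}. c \<alpha> * (\<Prod>i\<in>UNIV. (x $ i) ^ \<alpha> i))"
    "q = (\<lambda>x. \<Sum>\<alpha>\<in>{\<alpha> :: 'a \<Rightarrow> nat. (\<Sum>i\<in>UNIV. \<alpha> i) \<le> l}. d \<alpha> * (\<Prod>i\<in>UNIV. (x $ i) ^ \<alpha> i))"
    using assms by (auto simp: polys_upto_def)
  then have "(\<lambda>x. p x * q x) = (\<lambda>x. \<Sum>\<alpha>\<in>{\<alpha> :: 'a \<Rightarrow> nat. (\<Sum>i\<in>UNIV. \<alpha> i) \<le> k}.
      \<Sum>\<beta>\<in>{\<beta> :: 'a \<Rightarrow> nat. (\<Sum>i\<in>UNIV. \<beta> i) \<le> l}. (c \<alpha> * d \<beta>) * (\<Prod>i\<in>UNIV. (x $ i) ^ (\<alpha> i + \<beta> i)))"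
    by (simp add: sum_product power_add prod.distrib mult_ac)
  also have "\<dots> \<in> polys_upto (k + l)"
    by (intro polys_upto_sum polys_upto_monomial finite_multiindices) (auto simp: sum.distrib add_mono)
  finally show ?thesis .
qed

lemma real_polynomial_function_iff_polys_upto:
  "real_polynomial_function (p :: real^'n \<Rightarrow> real) \<longleftrightarrow> (\<exists>k. p \<in> polys_upto k)"
proof
  assume "real_polynomial_function p"
  then show "\<exists>k. p \<in> polys_upto k"
  proof (induction rule: real_polynomial_function.induct)
    case (linear f)
    have "(\<Prod>j\<in>UNIV. (x $ j) ^ (if j = i then 1 else 0)) = x $ i" for i and x :: "real^'n"
      by (subst prod.mono_neutral_cong_right[where S = "{i}"]) auto
    then have "(\<lambda>x :: real^'n. f (axis i 1) * x $ i) \<in> polys_upto 1" for i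
      using polys_upto_monomial[of "\<lambda>j. if j = i then 1 else 0" 1 "f (axis i 1)"] by simp
    then have "(\<lambda>x. \<Sum>i\<in>UNIV. f (axis i 1) * x $ i) \<in> polys_upto 1"
      by (intro polys_upto_sum) auto
    also have "(\<lambda>x. \<Sum>i\<in>UNIV. f (axis i 1) * x $ i) = f"
    proof
      fix x :: "real^'n"
      have "f x = f (\<Sum>i\<in>UNIV. x $ i *\<^sub>R axis i 1)"
        by (metis basis_expansion scalar_mult_eq_scaleR)
      also have "\<dots> = (\<Sum>i\<in>UNIV. f (axis i 1) * x $ i)"
        using bounded_linear.linear[OF linear] by (simp add: linear_sum linear_scale mult_ac)
      finally show "(\<Sum>i\<in>UNIV. f (axis i 1) * x $ i) = f x" by simp
    qed
    finally show ?case by blast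
  next
    case (const c)
    show ?case using polys_upto_monomial[of "\<lambda>_. 0" 0 c] by auto
  next
    case (add f g)
    then obtain k l where "f \<in> polys_upto k" "g \<in> polys_upto l" by blast
    then have "(\<lambda>x. f x + g x) \<in> polys_upto (max k l)"
      by (intro polys_upto_add) (auto elim: polys_upto_mono)
    then show ?case by blast
  next
    case (mult f g)
    then show ?case using polys_upto_mult by blast
  qed
next
  assume "\<exists>k. p \<in> polys_upto k"
  then show "real_polynomial_function p"
    unfolding polys_upto_def mem_Collect_eq
    by (elim exE, hypsubst)
      (intro real_polynomial_function_sum real_polynomial_function_prod
          real_polynomial_function_power real_polynomial_function.intros bounded_linear_vec_nth
          finite_multiindices finite_class.finite_UNIV)
qed

definition sos_poly :: "('a::real_normed_vector \<Rightarrow> real) \<Rightarrow> bool" where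
  "sos_poly s \<longleftrightarrow> (\<exists>(N::nat) q. (\<forall>i<N. real_polynomial_function (q i)) \<and> s = (\<lambda>x. \<Sum>i<N. (q i x)\<^sup>2))"

text \<open>The parameter \<open>r\<close> bounds the squared norm, so this is not \<^term>\<open>cball 0 r\<close>.\<close>

definition sqball :: "real \<Rightarrow> (real^'n) set" where
  "sqball r = {x. (norm x)\<^sup>2 \<le> r}"

definition policies :: "(real^'m) set \<Rightarrow> (nat \<Rightarrow> real^'m) set" where
  "policies D = {\<pi>. \<forall>k. \<pi> k \<in> D}"

primrec trajectory :: "(real^'n \<Rightarrow> real^'m \<Rightarrow> real^'n) \<Rightarrow> real^'n \<Rightarrow> (nat \<Rightarrow> real^'m) \<Rightarrow> nat \<Rightarrow> real^'n" where
  "trajectory f x0 \<pi> 0 = x0"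
| "trajectory f x0 \<pi> (Suc k) = f (trajectory f x0 \<pi> k) (\<pi> k)"

definition unif_loc_exp_stable ::
  "(real^'n \<Rightarrow> real^'m \<Rightarrow> real^'n) \<Rightarrow> (real^'m) set \<Rightarrow> (real^'n) set \<Rightarrow> bool" where
  "unif_loc_exp_stable f D X \<longleftrightarrow>
    (\<exists>M>0. \<exists>r>0. \<exists>lam. 0 < lam \<and> lam < 1 \<and> sqball r \<subseteq> X \<and>
      (\<forall>x0\<in>sqball r. \<forall>\<pi>\<in>policies D. \<forall>k. norm (trajectory f x0 \<pi> k) \<le> lam ^ k * M * norm x0))"

definition max_robust_roa ::
  "(real^'n \<Rightarrow> real^'m \<Rightarrow> real^'n) \<Rightarrow> (real^'m) set \<Rightarrow> (real^'n) set \<Rightarrow> (real^'n) set" where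
  "max_robust_roa f D X =
    {x0. (\<forall>k. \<forall>\<pi>\<in>policies D. trajectory f x0 \<pi> k \<in> X) \<and>
         (\<forall>\<pi>\<in>policies D. (\<lambda>k. trajectory f x0 \<pi> k) \<longlonglongrightarrow> 0)}"

definition robust_roa ::
  "(real^'n \<Rightarrow> real^'m \<Rightarrow> real^'n) \<Rightarrow> (real^'m) set \<Rightarrow> (real^'n) set \<Rightarrow> (real^'n) set \<Rightarrow> bool" where
  "robust_roa f D X S \<longleftrightarrow> S \<subseteq> max_robust_roa f D X"

definition reach_one ::
  "(real^'n \<Rightarrow> real^'m \<Rightarrow> real^'n) \<Rightarrow> (real^'m) set \<Rightarrow> (real^'n) set \<Rightarrow> (real^'n) set" where
  "reach_one f D X = {x. \<exists>x0\<in>X. \<exists>d\<in>D. x = f x0 d} \<union> X"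

definition pos_id :: "real \<Rightarrow> real" where
  "pos_id x = (if x \<ge> 0 then x else 0)"

text \<open>
  The infimum is taken in the extended reals, so that it is \<open>\<infinity>\<close> for an empty \<open>D\<close> rather than
  the unspecified real \<^term>\<open>Inf {} :: real\<close>.
\<close>

definition bellman_solution ::
  "(real^'n \<Rightarrow> real^'m \<Rightarrow> real^'n) \<Rightarrow> (real^'m) set \<Rightarrow> (real^'n \<Rightarrow> real) \<Rightarrow>
   nat \<Rightarrow> (nat \<Rightarrow> real^'n \<Rightarrow> real) \<Rightarrow> (real^'n \<Rightarrow> real) \<Rightarrow> bool" where
  "bellman_solution f D g nX hX v \<longleftrightarrow>
    (\<forall>x. v x \<in> {0..1}) \<and> bounded (range v) \<and> continuous_on UNIV v \<and>
    (\<forall>x. min (INF d\<in>D. ereal (v x - v (f x d) - g x * (1 - v x)))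
             (ereal (v x - 1 + (MIN j\<in>{1..nX}. pos_id (1 - hX j x)))) = 0) \<and>
    v 0 = 0"

definition h0 :: "real^'n \<Rightarrow> real" where
  "h0 x = (\<Sum>i\<in>UNIV. (x $ i)\<^sup>2)"

definition sos_solution ::
  "(real^'n \<Rightarrow> real^'m \<Rightarrow> real^'n) \<Rightarrow> nat \<Rightarrow> (nat \<Rightarrow> real^'m \<Rightarrow> real) \<Rightarrow>
   nat \<Rightarrow> (nat \<Rightarrow> real^'n \<Rightarrow> real) \<Rightarrow> (real^'n \<Rightarrow> real) \<Rightarrow> real \<Rightarrow> (real^'n \<Rightarrow> real) \<Rightarrow> nat \<Rightarrow>
   (real^'n \<Rightarrow> real) \<Rightarrow>
   ((real^'n) \<times> (real^'m) \<Rightarrow> real) \<Rightarrow> ((real^'n) \<times> (real^'m) \<Rightarrow> real) \<Rightarrow> ((real^'n) \<times> (real^'m) \<Rightarrow> real) \<Rightarrow>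
   (nat \<Rightarrow> (real^'n) \<times> (real^'m) \<Rightarrow> real) \<Rightarrow>
   (nat \<Rightarrow> real^'n \<Rightarrow> real) \<Rightarrow> (nat \<Rightarrow> real^'n \<Rightarrow> real) \<Rightarrow> (nat \<Rightarrow> real^'n \<Rightarrow> real) \<Rightarrow>
   (nat \<Rightarrow> real^'n \<Rightarrow> real) \<Rightarrow> (nat \<Rightarrow> real^'n \<Rightarrow> real) \<Rightarrow>
   (nat \<Rightarrow> nat \<Rightarrow> real^'n \<Rightarrow> real) \<Rightarrow> bool" where
  "sos_solution f md hD nX hX g R hinf k u s0 s1 s2 s3 s4 s5 s6 s7 s8 s9 \<longleftrightarrow>
    u \<in> polys_upto k \<and>
    sos_poly s0 \<and> sos_poly s1 \<and> sos_poly s2 \<and> (\<forall>i\<in>{1..md}. sos_poly (s3 i)) \<and>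
    (\<forall>j\<in>{1..nX}. sos_poly (s4 j) \<and> sos_poly (s5 j) \<and> sos_poly (s6 j) \<and>
                  sos_poly (s7 j) \<and> sos_poly (s8 j) \<and> (\<forall>l\<in>{1..nX}. sos_poly (s9 l j))) \<and>
    (\<forall>x d. u x - u (f x d) - g x * (1 - u x) =
       s0 (x, d) + s1 (x, d) * (R - h0 x) + s2 (x, d) * (hinf x - 1)
       - (\<Sum>i=1..md. s3 i (x, d) * hD i d)) \<and>
    (\<forall>j\<in>{1..nX}. \<forall>x. u x - 1 = s4 j x + s5 j x * (R - h0 x) + s6 j x * (hX j x - 1)) \<and>
    (\<forall>j\<in>{1..nX}. \<forall>x. u x - hX j x =
       s7 j x + s8 j x * (R - h0 x) + (\<Sum>l=1..nX. s9 l j x * (1 - hX l x)))"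

end

theory Submission
  imports Defs
begin

text \<open>
  The Bellman equation makes \<open>v\<close> satisfy non-strictly the three inequalities which the program asks
  of \<open>u\<close>: the decrease condition
  \<open>v(x) - v(f(x, d)) - g(x) (1 - v(x)) \<ge> 0\<close>, the bound \<open>v \<ge> 1\<close> outside the state constraints, and
  \<open>v \<ge> hX j\<close> where all \<open>hX l \<le> 1\<close>. For a constant \<open>\<eta> > 0\<close> the function \<open>v + \<eta>\<close> satisfies the last
  two strictly, and the first with margin \<open>\<eta> g(x)\<close>. This margin is bounded away from zero where
  the first identity needs it, namely on the part of the ball with \<open>hinf \<ge> 1\<close>: that set is compact
  and avoids the origin, which is the only zero of \<open>g\<close>. Hence every polynomial \<open>u\<close> close enough to
  \<open>v + \<eta>\<close> is strictly feasible, lies above \<open>v\<close>, and is uniformly near to it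
  (\<open>strict_polynomial_supersolution\<close>).

  Strict positivity on the compact semialgebraic sets is turned into sums of squares by Putinar's
  Positivstellensatz (\<open>putinar_positivstellensatz\<close>): a polynomial that is positive wherever all
  members of an archimedean quadratic module are nonnegative belongs to the module. The ball
  constraints on \<open>x\<close> and \<open>d\<close> make the modules in question archimedean. The Positivstellensatz is
  proved algebraically. Zorn's lemma extends a proper module to a maximal one, which is total and so
  comes from a point of the space (\<open>maximal_archimedean_has_point\<close>); applied to the module
  with \<open>-p\<close> adjoined this produces \<open>s p - 1 \<in> M\<close> with a sum of squares \<open>s\<close>, and a descent on
  the constant \<open>r\<close> in \<open>p + r \<in> M\<close> eliminates \<open>s\<close>.
\<close>

section \<open>Sums of squares\<close>

text \<open>
  The rule for bounded linear functions is left out: it matches every goal and would preempt the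
  structural rules.
\<close>
lemmas poly_intros =
  real_polynomial_function.intros(2-4) real_polynomial_function_minus real_polynomial_function_diff
  real_polynomial_function_power real_polynomial_function_sum

lemma sos_poly_zero: "sos_poly (\<lambda>_. 0)"
  unfolding sos_poly_def by (rule exI[of _ 0]) auto

lemma sos_poly_square:
  assumes "real_polynomial_function a" shows "sos_poly (\<lambda>x. (a x)\<^sup>2)"
  unfolding sos_poly_def by (rule exI[of _ 1], rule exI[of _ "\<lambda>_. a"]) (use assms in auto)

lemma sos_poly_one: "sos_poly (\<lambda>_. 1)"
  using sos_poly_square[OF real_polynomial_function.intros(2)[of 1]] by simp

lemma sos_poly_real_polynomial_function:
  assumes "sos_poly s" shows "real_polynomial_function s"
  using assms unfolding sos_poly_def
  by (auto intro!: poly_intros)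

lemma sos_poly_square_mult:
  assumes "sos_poly s" "real_polynomial_function a"
  shows "sos_poly (\<lambda>x. (a x)\<^sup>2 * s x)"
proof -
  obtain N :: nat and q where q: "\<forall>i<N. real_polynomial_function (q i)"
    and s: "s = (\<lambda>x. \<Sum>i<N. (q i x)\<^sup>2)"
    using assms(1) unfolding sos_poly_def by blast
  have "(\<lambda>x. (a x)\<^sup>2 * s x) = (\<lambda>x. \<Sum>i<N. (a x * q i x)\<^sup>2)"
    by (simp add: s power_mult_distrib sum_distrib_left)
  moreover have "\<forall>i<N. real_polynomial_function (\<lambda>x. a x * q i x)"
    using q assms(2) by (auto intro!: poly_intros)
  ultimately show ?thesis
    unfolding sos_poly_def by (intro exI[of _ N] exI[of _ "\<lambda>i x. a x * q i x"]) simp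
qed

lemma sos_poly_add:
  assumes "sos_poly s" "sos_poly t" shows "sos_poly (\<lambda>x. s x + t x)"
proof -
  obtain N :: nat and q where q: "\<forall>i<N. real_polynomial_function (q i)" "s = (\<lambda>x. \<Sum>i<N. (q i x)\<^sup>2)"
    using assms(1) unfolding sos_poly_def by blast
  obtain K :: nat and p where p: "\<forall>i<K. real_polynomial_function (p i)" "t = (\<lambda>x. \<Sum>i<K. (p i x)\<^sup>2)"
    using assms(2) unfolding sos_poly_def by blast
  define r where "r i = (if i < N then q i else p (i - N))" for i
  have "(\<Sum>i<N + L. (r i x)\<^sup>2) = (\<Sum>i<N. (q i x)\<^sup>2) + (\<Sum>i<L. (p i x)\<^sup>2)" for L x
    by (induction L) (simp_all add: r_def)
  then have "(\<lambda>x. s x + t x) = (\<lambda>x. \<Sum>i<N + K. (r i x)\<^sup>2)"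
    by (simp add: q(2) p(2))
  moreover have "\<forall>i<N + K. real_polynomial_function (r i)"
    using q(1) p(1) by (simp add: r_def)
  ultimately show ?thesis unfolding sos_poly_def by (intro exI conjI)
qed

section \<open>Quadratic modules\<close>

locale quadratic_module =
  fixes M :: "('a::euclidean_space \<Rightarrow> real) set"
  assumes polynomial: "p \<in> M \<Longrightarrow> real_polynomial_function p"
    and one: "(\<lambda>_. 1) \<in> M"
    and add: "\<lbrakk>p \<in> M; q \<in> M\<rbrakk> \<Longrightarrow> (\<lambda>x. p x + q x) \<in> M"
    and square_mult: "\<lbrakk>p \<in> M; real_polynomial_function a\<rbrakk> \<Longrightarrow> (\<lambda>x. (a x)\<^sup>2 * p x) \<in> M"
begin

lemma scale:
  assumes "c \<ge> 0" "p \<in> M" shows "(\<lambda>x. c * p x) \<in> M"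
  using square_mult[OF assms(2), of "\<lambda>_. sqrt c"] assms(1) by (simp add: poly_intros)

lemma const: "c \<ge> 0 \<Longrightarrow> (\<lambda>_. c) \<in> M"
  using scale[OF _ one, of c] by simp

lemma square: "real_polynomial_function a \<Longrightarrow> (\<lambda>x. (a x)\<^sup>2) \<in> M"
  using square_mult[OF one] by simp

lemma sum:
  assumes "finite I" "\<And>i. i \<in> I \<Longrightarrow> p i \<in> M" shows "(\<lambda>x. \<Sum>i\<in>I. p i x) \<in> M"
  using assms by (induction I rule: finite_induct) (auto intro: add const)

lemma sos_mult:
  assumes "sos_poly s" "p \<in> M" shows "(\<lambda>x. s x * p x) \<in> M"
  using assms by (auto simp: sos_poly_def sum_distrib_right intro!: sum square_mult)

lemma sos: "sos_poly s \<Longrightarrow> s \<in> M"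
  using sos_mult[OF _ one] by simp

lemma add_const:
  assumes "(\<lambda>x. c + p x) \<in> M" "c \<le> d" shows "(\<lambda>x. d + p x) \<in> M"
  using add[OF assms(1) const[of "d - c"]] assms(2) by (simp add: algebra_simps)

text \<open>
  The support \<open>M \<inter> -M\<close> is an ideal, because every polynomial is a difference of two squares:
  \<open>a = ((a + 1)/2)\<^sup>2 - ((a - 1)/2)\<^sup>2\<close>.
\<close>
lemma support_mult:
  assumes "p \<in> M" "(\<lambda>x. - p x) \<in> M" "real_polynomial_function a"
  shows "(\<lambda>x. a x * p x) \<in> M"
proof -
  have "real_polynomial_function (\<lambda>x. 1 / 2 * (a x + 1))" "real_polynomial_function (\<lambda>x. 1 / 2 * (a x - 1))"
    using assms(3) by (intro poly_intros; assumption)+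
  then have "(\<lambda>x. (1 / 2 * (a x + 1))\<^sup>2 * p x + (1 / 2 * (a x - 1))\<^sup>2 * - p x) \<in> M"
    by (intro add square_mult[OF assms(1)] square_mult[OF assms(2)])
  moreover have "(1 / 2 * (a x + 1))\<^sup>2 * p x + (1 / 2 * (a x - 1))\<^sup>2 * - p x = a x * p x" for x
    by (simp add: power2_eq_square field_simps)
  ultimately show ?thesis by (simp only:)
qed

text \<open>
  A quadratic module need not contain the product \<open>(c - a) (c + a)\<close> of two of its elements, but it does
  contain squares times elements, and
  \<open>2c (c\<^sup>2 - a\<^sup>2) = (c - a)\<^sup>2 (c + a) + (c + a)\<^sup>2 (c - a)\<close>.
\<close>
lemma bound_square:
  assumes "(\<lambda>x. c - a x) \<in> M" "(\<lambda>x. c + a x) \<in> M" "c > 0" "real_polynomial_function a"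
  shows "(\<lambda>x. c\<^sup>2 - (a x)\<^sup>2) \<in> M"
proof -
  have a_bounds: "real_polynomial_function (\<lambda>x. c - a x)" "real_polynomial_function (\<lambda>x. c + a x)"
    using assms(4) by (intro poly_intros; assumption)+
  have "(\<lambda>x. 1 / (2 * c) * ((c - a x)\<^sup>2 * (c + a x) + (c + a x)\<^sup>2 * (c - a x))) \<in> M"
    by (rule scale[OF _ add[OF square_mult[OF assms(2) a_bounds(1)] square_mult[OF assms(1) a_bounds(2)]]])
      (use assms(3) in simp)
  moreover have "(c - a x)\<^sup>2 * (c + a x) + (c + a x)\<^sup>2 * (c - a x) = 2 * c * (c\<^sup>2 - (a x)\<^sup>2)" for x
    by (simp add: power2_eq_square algebra_simps)
  moreover have "1 / (2 * c) * (2 * c * y) = y" for y :: real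
    using assms(3) by simp
  ultimately show ?thesis by (simp only:)
qed

end

lemma quadratic_module_sos: "quadratic_module (Collect (sos_poly :: ('a::euclidean_space \<Rightarrow> real) \<Rightarrow> bool))"
  by unfold_locales
    (auto intro: sos_poly_real_polynomial_function sos_poly_one sos_poly_add sos_poly_square_mult)

text \<open>
  Generators are adjoined in families, so that the nested applications used for the certificates
  unfold to weighted sums of exactly the shape prescribed by the sum-of-squares program.
\<close>
definition adjoin :: "('a \<Rightarrow> real) set \<Rightarrow> 'i set \<Rightarrow> ('i \<Rightarrow> 'a \<Rightarrow> real) \<Rightarrow> ('a::real_normed_vector \<Rightarrow> real) set" where
  "adjoin M I q = {p. \<exists>m\<in>M. \<exists>s. (\<forall>i\<in>I. sos_poly (s i)) \<and> p = (\<lambda>x. m x + (\<Sum>i\<in>I. s i x * q i x))}"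

lemma adjoinI:
  "\<lbrakk>m \<in> M; \<And>i. i \<in> I \<Longrightarrow> sos_poly (s i); \<And>x. p x = m x + (\<Sum>i\<in>I. s i x * q i x)\<rbrakk> \<Longrightarrow> p \<in> adjoin M I q"
  unfolding adjoin_def by (auto intro!: bexI[of _ m] exI[of _ s])

lemma adjoin_base: "m \<in> M \<Longrightarrow> m \<in> adjoin M I q"
  by (rule adjoinI[where s = "\<lambda>_ _. 0"]) (auto intro: sos_poly_zero)

lemma quadratic_module_adjoin:
  assumes "quadratic_module M" "finite I" "\<And>i. i \<in> I \<Longrightarrow> real_polynomial_function (q i)"
  shows "quadratic_module (adjoin M I q)"
proof -
  interpret quadratic_module M by fact
  show ?thesis
  proof
    fix p assume "p \<in> adjoin M I q"
    then show "real_polynomial_function p"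
      unfolding adjoin_def using assms(2,3) polynomial
      by (auto intro!: poly_intros dest: sos_poly_real_polynomial_function)
  next
    show "(\<lambda>_. 1) \<in> adjoin M I q" by (intro adjoin_base one)
  next
    fix p p' assume "p \<in> adjoin M I q" "p' \<in> adjoin M I q"
    then obtain m s m' s' where "m \<in> M" "m' \<in> M" "\<forall>i\<in>I. sos_poly (s i)" "\<forall>i\<in>I. sos_poly (s' i)"
      "p = (\<lambda>x. m x + (\<Sum>i\<in>I. s i x * q i x))" "p' = (\<lambda>x. m' x + (\<Sum>i\<in>I. s' i x * q i x))"
      unfolding adjoin_def by blast
    then show "(\<lambda>x. p x + p' x) \<in> adjoin M I q"
      by (intro adjoinI[where m = "\<lambda>x. m x + m' x" and s = "\<lambda>i x. s i x + s' i x"])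
        (auto intro: add sos_poly_add simp: sum.distrib distrib_right)
  next
    fix p a assume a: "real_polynomial_function (a :: 'a \<Rightarrow> real)" and "p \<in> adjoin M I q"
    then obtain m s where "m \<in> M" "\<forall>i\<in>I. sos_poly (s i)" "p = (\<lambda>x. m x + (\<Sum>i\<in>I. s i x * q i x))"
      unfolding adjoin_def by blast
    then show "(\<lambda>x. (a x)\<^sup>2 * p x) \<in> adjoin M I q" using a
      by (intro adjoinI[where m = "\<lambda>x. (a x)\<^sup>2 * m x" and s = "\<lambda>i x. (a x)\<^sup>2 * s i x"])
        (auto intro: square_mult sos_poly_square_mult simp: distrib_left sum_distrib_left mult.assoc)
  qed
qed

lemma adjoin_generator:
  assumes "quadratic_module M" "finite I" "i \<in> I" shows "q i \<in> adjoin M I q"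
proof -
  interpret quadratic_module M by fact
  have "q i x = 0 + (\<Sum>k\<in>I. (if k = i then 1 else 0) * q k x)" for x
    using assms(2,3) by (subst sum.mono_neutral_right[of _ "{i}"]) auto
  then show ?thesis
    by (intro adjoinI[where m = "\<lambda>_. 0" and s = "\<lambda>k _. if k = i then 1 else 0"])
      (auto intro: const sos_poly_zero sos_poly_one)
qed

section \<open>Archimedean modules\<close>

text \<open>
  A one-sided bound suffices, since it is demanded for \<open>a\<close> and for \<open>-a\<close>.
\<close>
definition archimedean :: "('a::real_normed_vector \<Rightarrow> real) set \<Rightarrow> bool" where
  "archimedean M \<longleftrightarrow> (\<forall>a. real_polynomial_function a \<longrightarrow> (\<exists>N. (\<lambda>x. N - a x) \<in> M))"

lemma bounded_linear_eq_sum_Basis: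
  fixes h :: "'a::euclidean_space \<Rightarrow> real"
  assumes "bounded_linear h"
  shows "h = (\<lambda>x. \<Sum>b\<in>Basis. h b * (x \<bullet> b))"
proof
  fix x
  have "h x = h (\<Sum>b\<in>Basis. (x \<bullet> b) *\<^sub>R b)" by (simp add: euclidean_representation)
  also have "\<dots> = (\<Sum>b\<in>Basis. h b * (x \<bullet> b))"
    using bounded_linear.linear[OF assms] by (simp add: linear_sum linear_scale mult.commute)
  finally show "h x = (\<Sum>b\<in>Basis. h b * (x \<bullet> b))" .
qed

lemma archimedean_mono: "archimedean M \<Longrightarrow> M \<subseteq> S \<Longrightarrow> archimedean S"
  unfolding archimedean_def by blast

text \<open>
  A bound on the norm bounds every coordinate, and the polynomials bounded modulo \<open>M\<close> form a
  subalgebra. Closure under products reduces to squares by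
  \<open>4ab = (a + b)\<^sup>2 - (a - b)\<^sup>2\<close>.
\<close>
lemma archimedean_if_ball:
  fixes M :: "('a::euclidean_space \<Rightarrow> real) set"
  assumes "quadratic_module M" and ball: "(\<lambda>x. c - (norm x)\<^sup>2) \<in> M"
  shows "archimedean M"
proof -
  interpret quadratic_module M by fact
  define bd where "bd a \<longleftrightarrow> (\<exists>N>0. (\<lambda>x. N - a x) \<in> M \<and> (\<lambda>x. N + a x) \<in> M)" for a :: "'a \<Rightarrow> real"
  have bdI: "bd a" if "(\<lambda>x. N - a x) \<in> M" "(\<lambda>x. N + a x) \<in> M" for a N
    unfolding bd_def
    using add_const[of N "\<lambda>x. - a x" "max 1 N"] add_const[of N a "max 1 N"] that
    by (intro exI[of _ "max 1 N"]) auto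
  have bd_add: "bd (\<lambda>x. a x + b x)" if ab: "bd a" "bd b" for a b
  proof -
    obtain N K where "(\<lambda>x. N - a x) \<in> M" "(\<lambda>x. N + a x) \<in> M" "(\<lambda>x. K - b x) \<in> M" "(\<lambda>x. K + b x) \<in> M"
      using ab unfolding bd_def by blast
    with add[of "\<lambda>x. N - a x" "\<lambda>x. K - b x"] add[of "\<lambda>x. N + a x" "\<lambda>x. K + b x"] show ?thesis
      by (intro bdI[of "N + K"]) (simp_all add: algebra_simps)
  qed
  have bd_scale: "bd (\<lambda>x. t * a x)" if a: "bd a" for a t
  proof -
    obtain N where N: "(\<lambda>x. N - a x) \<in> M" "(\<lambda>x. N + a x) \<in> M"
      using a unfolding bd_def by blast
    show ?thesis
      using scale[OF _ N(1), of "\<bar>t\<bar>"] scale[OF _ N(2), of "\<bar>t\<bar>"]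
      by (intro bdI[of "\<bar>t\<bar> * N"]) (cases "t \<ge> 0"; simp add: algebra_simps)+
  qed
  have bd_square: "bd (\<lambda>x. (a x)\<^sup>2)" if a: "bd a" "real_polynomial_function a" for a
  proof -
    obtain N where "N > 0" "(\<lambda>x. N - a x) \<in> M" "(\<lambda>x. N + a x) \<in> M"
      using a unfolding bd_def by blast
    then show ?thesis
      using bound_square[of N a] add[OF const[of "N\<^sup>2"] square[of a]] a
      by (intro bdI[of "N\<^sup>2"]) auto
  qed
  have bd_basis: "bd (\<lambda>x. x \<bullet> b)" if b: "b \<in> Basis" for b
  proof -
    have lin: "real_polynomial_function (\<lambda>x. x \<bullet> b')" for b' :: 'a
      by (intro real_polynomial_function.intros(1) bounded_linear_inner_left)
    have eq: "c - (norm x)\<^sup>2 + (\<Sum>b'\<in>Basis - {b}. (x \<bullet> b')\<^sup>2) = c - (x \<bullet> b)\<^sup>2" for x :: 'a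
    proof -
      have "(norm x)\<^sup>2 = (\<Sum>b'\<in>Basis. (x \<bullet> b')\<^sup>2)"
        unfolding power2_norm_eq_inner by (subst euclidean_inner) (simp add: power2_eq_square)
      then show ?thesis using b by (simp add: sum.remove[of _ b])
    qed
    have "(\<lambda>x. c - (norm x)\<^sup>2 + (\<Sum>b'\<in>Basis - {b}. (x \<bullet> b')\<^sup>2)) \<in> M"
      by (intro add ball sum square lin) simp
    then have *: "(\<lambda>x. c - (x \<bullet> b)\<^sup>2) \<in> M"
      by (simp only: eq)
    show ?thesis
    proof (rule bdI[of "c + 1 / 4"])
      show "(\<lambda>x. c + 1 / 4 - x \<bullet> b) \<in> M"
        using add[OF * square[of "\<lambda>x. x \<bullet> b - 1 / 2"]] lin
        by (simp add: poly_intros power2_eq_square algebra_simps)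
      show "(\<lambda>x. c + 1 / 4 + x \<bullet> b) \<in> M"
        using add[OF * square[of "\<lambda>x. x \<bullet> b + 1 / 2"]] lin
        by (simp add: poly_intros power2_eq_square algebra_simps)
    qed
  qed
  have "bd a" if "real_polynomial_function a" for a
    using that
  proof (induction rule: real_polynomial_function.induct)
    case (linear h)
    have sum_bd: "bd (\<lambda>x. \<Sum>b\<in>B. h b * (x \<bullet> b))" if "finite B" "B \<subseteq> Basis" for B
      using that
    proof (induction B rule: finite_induct)
      case empty
      then show ?case using const[of 1] by (auto intro: bdI[of 1])
    next
      case (insert b B)
      then show ?case by (auto intro!: bd_add bd_scale bd_basis)
    qed
    have "h = (\<lambda>x. \<Sum>b\<in>Basis. h b * (x \<bullet> b))"
      using linear by (rule bounded_linear_eq_sum_Basis)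
    with sum_bd[of Basis] show ?case by (metis finite_Basis order_refl)
  next
    case (const k)
    show ?case using quadratic_module.const[OF assms(1)] by (intro bdI[of "\<bar>k\<bar>"]) auto
  next
    case (add a b)
    then show ?case by (intro bd_add)
  next
    case (mult a b)
    have "bd (\<lambda>x. 1 / 4 * (a x + b x)\<^sup>2 + (- 1 / 4) * (a x + (- 1) * b x)\<^sup>2)"
      using mult
      by (intro bd_add bd_scale bd_square) (auto intro!: poly_intros)
    moreover have "1 / 4 * (y + w)\<^sup>2 + (- 1 / 4) * (y + (- 1) * w)\<^sup>2 = y * w" for y w :: real
      by (simp add: power2_eq_square field_simps)
    ultimately show ?case by (simp only:)
  qed
  then show ?thesis unfolding archimedean_def bd_def by blast
qed

section \<open>Putinar's Positivstellensatz\<close>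

lemma exists_maximal_proper_quadratic_module:
  fixes M :: "('a::euclidean_space \<Rightarrow> real) set"
  assumes M: "quadratic_module M" "(\<lambda>_. - 1) \<notin> M"
  obtains S where "quadratic_module S" "M \<subseteq> S" "(\<lambda>_. - 1) \<notin> S"
    "\<And>T. quadratic_module T \<Longrightarrow> S \<subseteq> T \<Longrightarrow> (\<lambda>_. - 1) \<notin> T \<Longrightarrow> T = S"
proof -
  let ?F = "{S. quadratic_module S \<and> M \<subseteq> S \<and> (\<lambda>_. - 1) \<notin> S}"
  have "\<exists>S\<in>?F. \<forall>T\<in>?F. S \<subseteq> T \<longrightarrow> T = S"
  proof (rule subset_Zorn_nonempty)
    show "?F \<noteq> {}" using M by blast
  next
    fix C assume C: "C \<noteq> {}" "subset.chain ?F C"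
    have qm: "quadratic_module S" "M \<subseteq> S" "(\<lambda>_. - 1) \<notin> S" if "S \<in> C" for S
      using C(2) that unfolding subset.chain_def by auto
    have "quadratic_module (\<Union> C)"
    proof
      fix p assume "p \<in> \<Union> C"
      then show "real_polynomial_function p" using qm quadratic_module.polynomial by blast
    next
      show "(\<lambda>_. 1) \<in> \<Union> C" using C(1) qm quadratic_module.one by blast
    next
      fix p q assume "p \<in> \<Union> C" "q \<in> \<Union> C"
      then obtain S T where ST: "S \<in> C" "p \<in> S" "T \<in> C" "q \<in> T" by blast
      then have "S \<subseteq> T \<or> T \<subseteq> S" using C(2) unfolding subset.chain_def by blast
      then obtain U where "U \<in> C" "p \<in> U" "q \<in> U" using ST by blast
      then show "(\<lambda>x. p x + q x) \<in> \<Union> C" using qm(1) quadratic_module.add by blast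
    next
      fix p a assume "p \<in> \<Union> C" "real_polynomial_function (a :: 'a \<Rightarrow> real)"
      then show "(\<lambda>x. (a x)\<^sup>2 * p x) \<in> \<Union> C" using qm(1) quadratic_module.square_mult by blast
    qed
    then show "\<Union> C \<in> ?F" using qm C(1) by blast
  qed
  then obtain S where S: "S \<in> ?F" "\<forall>T\<in>?F. S \<subseteq> T \<longrightarrow> T = S" by (elim bexE)
  show thesis
  proof (rule that)
    fix T assume T: "quadratic_module T" "S \<subseteq> T" "(\<lambda>_. - 1) \<notin> T"
    then have "T \<in> ?F" using S(1) by auto
    with S(2) T(2) show "T = S" by simp
  qed (use S(1) in simp_all)
qed

text \<open>
  If neither \<open>a\<close> nor \<open>-a\<close> lies in \<open>S\<close>, maximality gives \<open>-1 = m + s a\<close> and \<open>-1 = n - t a\<close> with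
  \<open>m, n \<in> S\<close> and sums of squares \<open>s, t\<close>. Eliminating \<open>a\<close> yields \<open>-s = t + t m + s n \<in> S\<close>. So
  \<open>s\<close> is in the support, hence so is \<open>s a\<close>, and \<open>-1 = m + s a \<in> S\<close>, a contradiction.
\<close>
lemma maximal_quadratic_module_total:
  fixes S :: "('a::euclidean_space \<Rightarrow> real) set"
  assumes S: "quadratic_module S" "(\<lambda>_. - 1) \<notin> S"
    and maximal: "\<And>T. quadratic_module T \<Longrightarrow> S \<subseteq> T \<Longrightarrow> (\<lambda>_. - 1) \<notin> T \<Longrightarrow> T = S"
    and a: "real_polynomial_function a"
  shows "a \<in> S \<or> (\<lambda>x. - a x) \<in> S"
proof (rule ccontr)
  assume neg: "\<not> ?thesis"
  interpret quadratic_module S by fact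
  have certificate: "\<exists>m s. m \<in> S \<and> sos_poly s \<and> (\<forall>x. - 1 = m x + s x * b x)"
    if b: "real_polynomial_function b" "b \<notin> S" for b
  proof -
    let ?T = "adjoin S {()} (\<lambda>_. b)"
    have "quadratic_module ?T"
      using b(1) by (intro quadratic_module_adjoin[OF S(1)]) auto
    moreover have "S \<subseteq> ?T" by (auto intro: adjoin_base)
    moreover have "b \<in> ?T" using adjoin_generator[OF S(1), of "{()}" "()" "\<lambda>_. b"] by simp
    ultimately have "(\<lambda>_. - 1) \<in> ?T" using maximal b(2) by blast
    then show ?thesis unfolding adjoin_def by (auto simp: fun_eq_iff)
  qed
  obtain m s where m: "m \<in> S" "sos_poly s" and ms: "\<And>x. - 1 = m x + s x * a x"
    using certificate[OF a] neg by blast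
  obtain n t where n: "n \<in> S" "sos_poly t" and nt: "\<And>x. - 1 = n x + t x * - a x"
    using certificate[of "\<lambda>x. - a x"] neg a by (auto simp: real_polynomial_function_minus)
  have eq: "t x + (t x * m x + s x * n x) = - s x" for x
  proof -
    have m_eq: "m x = - 1 - s x * a x" and n_eq: "n x = - 1 + t x * a x"
      using ms[of x] nt[of x] by simp_all
    show ?thesis unfolding m_eq n_eq by (simp add: algebra_simps)
  qed
  have "(\<lambda>x. t x + (t x * m x + s x * n x)) \<in> S"
    by (intro add sos sos_mult m n)
  then have "(\<lambda>x. - s x) \<in> S" by (simp only: eq)
  then have "(\<lambda>x. a x * s x) \<in> S" by (rule support_mult[OF sos[OF m(2)] _ a])
  from add[OF m(1) this] have "(\<lambda>_. - 1) \<in> S" using ms by (simp add: mult.commute)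
  with S(2) show False by simp
qed

text \<open>
  A total archimedean \<open>S\<close> orders the polynomials with the reals cofinal, so every polynomial is
  infinitesimally close to a real number, its standard part. Taking standard parts respects
  sums and products, hence it is evaluation at the point \<open>z\<close> whose coordinates are the standard
  parts of the coordinate functions. Elements of \<open>S\<close> have nonnegative standard part.
\<close>
lemma maximal_archimedean_has_point:
  fixes S :: "('a::euclidean_space \<Rightarrow> real) set"
  assumes S: "quadratic_module S" "(\<lambda>_. - 1) \<notin> S" "archimedean S"
    and total: "\<And>a. real_polynomial_function a \<Longrightarrow> a \<in> S \<or> (\<lambda>x. - a x) \<in> S"
  obtains x where "\<And>q. q \<in> S \<Longrightarrow> q x \<ge> 0"
proof -
  interpret quadratic_module S by fact
  have nonneg_const: "c \<ge> 0" if "(\<lambda>_. c) \<in> S" for c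
  proof (rule ccontr)
    assume "\<not> c \<ge> 0"
    then show False using scale[OF _ that, of "- 1 / c"] S(2) by simp
  qed
  \<comment> \<open>\<open>near a c\<close> says that \<open>a\<close> is infinitesimally close to \<open>c\<close> in the preorder \<open>b \<le> b' \<longleftrightarrow> b' - b \<in> S\<close>.\<close>
  define near where "near a c \<longleftrightarrow> (\<forall>e>0. (\<lambda>x. c + e - a x) \<in> S \<and> (\<lambda>x. a x - c + e) \<in> S)"
    for a :: "'a \<Rightarrow> real" and c
  have near_ex: "\<exists>c. near a c" if a: "real_polynomial_function a" for a
  proof -
    let ?U = "{r. (\<lambda>x. r - a x) \<in> S}"
    obtain N where N: "(\<lambda>x. N - a x) \<in> S" using S(3) a unfolding archimedean_def by blast
    obtain K where K: "(\<lambda>x. K - - a x) \<in> S"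
      using S(3) real_polynomial_function_minus[OF a] unfolding archimedean_def by blast
    have "r \<ge> - K" if "r \<in> ?U" for r
      using nonneg_const[of "r + K"] add[OF _ K, of "\<lambda>x. r - a x"] that by simp
    then have bdd: "bdd_below ?U" by (rule bdd_belowI)
    have "near a (Inf ?U)" unfolding near_def
    proof (intro allI impI conjI)
      fix e :: real assume e: "e > 0"
      have "Inf ?U < Inf ?U + e" using e by simp
      then obtain r where "(\<lambda>x. r - a x) \<in> S" "r < Inf ?U + e"
        using cInf_lessD[of ?U "Inf ?U + e"] N by blast
      then show "(\<lambda>x. Inf ?U + e - a x) \<in> S"
        using add_const[of r "\<lambda>x. - a x" "Inf ?U + e"] by simp
      have "Inf ?U - e \<notin> ?U" using cInf_lower[OF _ bdd, of "Inf ?U - e"] e by auto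
      then have "(\<lambda>x. - (Inf ?U - e - a x)) \<in> S"
        using total[of "\<lambda>x. Inf ?U - e - a x"] a
        by (auto simp: poly_intros)
      then show "(\<lambda>x. a x - Inf ?U + e) \<in> S" by (simp add: algebra_simps)
    qed
    then show ?thesis by blast
  qed
  have near_const: "near (\<lambda>_. c) c" for c
    unfolding near_def using const by simp
  have near_add: "near (\<lambda>x. a x + b x) (c + d)" if ab: "near a c" "near b d" for a b c d
    unfolding near_def
  proof (intro allI impI)
    fix e :: real assume "e > 0"
    then have "(\<lambda>x. c + e / 2 - a x) \<in> S" "(\<lambda>x. a x - c + e / 2) \<in> S"
      "(\<lambda>x. d + e / 2 - b x) \<in> S" "(\<lambda>x. b x - d + e / 2) \<in> S"
      using ab unfolding near_def by (meson half_gt_zero)+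
    from add[OF this(1,3)] add[OF this(2,4)]
    show "(\<lambda>x. c + d + e - (a x + b x)) \<in> S \<and> (\<lambda>x. a x + b x - (c + d) + e) \<in> S"
      by (simp add: algebra_simps)
  qed
  have near_scale: "near (\<lambda>x. t * a x) (t * c)" if a: "near a c" for a c t
  proof (cases "t = 0")
    case True
    then show ?thesis using near_const[of 0] by simp
  next
    case False
    show ?thesis unfolding near_def
    proof (intro allI impI)
      fix e :: real assume "e > 0"
      then have "e / \<bar>t\<bar> > 0" using False by simp
      then have "(\<lambda>x. c + e / \<bar>t\<bar> - a x) \<in> S" "(\<lambda>x. a x - c + e / \<bar>t\<bar>) \<in> S"
        using a unfolding near_def by blast+
      from scale[OF _ this(1), of "\<bar>t\<bar>"] scale[OF _ this(2), of "\<bar>t\<bar>"] False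
      show "(\<lambda>x. t * c + e - t * a x) \<in> S \<and> (\<lambda>x. t * a x - t * c + e) \<in> S"
        by (cases "t > 0") (simp_all add: algebra_simps)
    qed
  qed
  have near_square0: "near (\<lambda>x. (a x)\<^sup>2) 0" if a: "near a 0" "real_polynomial_function a" for a
    unfolding near_def
  proof (intro allI impI)
    fix e :: real assume e: "e > 0"
    then have "sqrt e > 0" by simp
    then have "(\<lambda>x. sqrt e - a x) \<in> S" "(\<lambda>x. sqrt e + a x) \<in> S"
      using a(1) unfolding near_def by (auto simp: add.commute)
    from bound_square[OF this] a e square[of a] add[OF square[of a] const[of e]]
    show "(\<lambda>x. 0 + e - (a x)\<^sup>2) \<in> S \<and> (\<lambda>x. (a x)\<^sup>2 - 0 + e) \<in> S" by simp
  qed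
  have near_square: "near (\<lambda>x. (a x)\<^sup>2) (c\<^sup>2)" if a: "near a c" "real_polynomial_function a" for a c
  proof -
    have shift: "near (\<lambda>x. a x + - c) (c + - c)" by (rule near_add[OF a(1) near_const])
    then have "near (\<lambda>x. (a x + - c)\<^sup>2) 0"
      using a(2) by (intro near_square0 poly_intros) simp_all
    from near_add[OF near_add[OF this near_scale[OF shift, of "2 * c"]] near_const[of "c\<^sup>2"]]
    have "near (\<lambda>x. (a x + - c)\<^sup>2 + 2 * c * (a x + - c) + c\<^sup>2) (c\<^sup>2)" by simp
    moreover have "(a x + - c)\<^sup>2 + 2 * c * (a x + - c) + c\<^sup>2 = (a x)\<^sup>2" for x
      by (simp add: power2_eq_square algebra_simps)
    ultimately show ?thesis by (simp only:)
  qed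
  have near_mult: "near (\<lambda>x. a x * b x) (c * d)"
    if ab: "near a c" "near b d" "real_polynomial_function a" "real_polynomial_function b" for a b c d
  proof -
    have "near (\<lambda>x. (a x + b x)\<^sup>2) ((c + d)\<^sup>2)"
      using ab by (intro near_square near_add) (auto intro!: poly_intros)
    moreover have "near (\<lambda>x. (a x + (- 1) * b x)\<^sup>2) ((c + (- 1) * d)\<^sup>2)"
      using ab by (intro near_square near_add near_scale) (auto intro!: poly_intros)
    ultimately have "near (\<lambda>x. 1 / 4 * (a x + b x)\<^sup>2 + (- 1 / 4) * (a x + (- 1) * b x)\<^sup>2)
        (1 / 4 * (c + d)\<^sup>2 + (- 1 / 4) * (c + (- 1) * d)\<^sup>2)"
      by (intro near_add near_scale)
    moreover have "1 / 4 * (y + w)\<^sup>2 + (- 1 / 4) * (y + (- 1) * w)\<^sup>2 = y * w" for y w :: real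
      by (simp add: power2_eq_square field_simps)
    ultimately show ?thesis by (simp only:)
  qed
  have "\<forall>b. \<exists>c. near (\<lambda>x. x \<bullet> b) c"
    using near_ex by (blast intro: real_polynomial_function.intros(1) bounded_linear_inner_left)
  then obtain \<xi> where \<xi>: "\<And>b. near (\<lambda>x. x \<bullet> b) (\<xi> b)" by metis
  define z where "z = (\<Sum>b\<in>Basis. \<xi> b *\<^sub>R b)"
  have near_z: "near p (p z)" if "real_polynomial_function p" for p
    using that
  proof (induction rule: real_polynomial_function.induct)
    case (linear h)
    have lin: "linear h" using linear by (rule bounded_linear.linear)
    have "near (\<lambda>x. \<Sum>b\<in>B. h b * (x \<bullet> b)) (\<Sum>b\<in>B. h b * \<xi> b)" if "finite B" for B
      using that
    proof (induction B rule: finite_induct)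
      case empty
      show ?case using near_const by simp
    next
      case (insert b B)
      show ?case using near_add[OF near_scale[OF \<xi>] insert.IH] insert.hyps by simp
    qed
    from this[of Basis]
    have "near (\<lambda>x. \<Sum>b\<in>Basis. h b * (x \<bullet> b)) (\<Sum>b\<in>Basis. h b * \<xi> b)" by simp
    moreover have "h = (\<lambda>x. \<Sum>b\<in>Basis. h b * (x \<bullet> b))"
      using linear by (rule bounded_linear_eq_sum_Basis)
    moreover have "h z = (\<Sum>b\<in>Basis. h b * \<xi> b)"
      unfolding z_def using lin by (simp add: linear_sum linear_scale mult.commute)
    ultimately show ?case by metis
  next
    case (const c)
    show ?case by (rule near_const)
  next
    case (add a b)
    then show ?case by (intro near_add)
  next
    case (mult a b)
    then show ?case by (intro near_mult)
  qed
  have "q z \<ge> 0" if q: "q \<in> S" for q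
  proof (rule field_le_epsilon)
    fix e :: real assume "e > 0"
    then have "(\<lambda>x. q z + e - q x) \<in> S" using near_z[OF polynomial[OF q]] unfolding near_def by blast
    from nonneg_const[of "q z + e"] add[OF this q] show "0 \<le> q z + e" by simp
  qed
  then show thesis by (rule that)
qed

text \<open>
  Suppose first that \<open>-1\<close> were not in \<open>M\<close> with \<open>-p\<close> adjoined. A maximal proper module above it
  would yield a point at which \<open>M\<close> is nonnegative but \<open>p\<close> is not positive. Hence
  \<open>s p - 1 \<in> M\<close> for some sum of squares \<open>s\<close>.

  The factor \<open>s\<close> is then removed by a descent. If \<open>p + r \<in> M\<close> for a constant \<open>r \<ge> 0\<close>, then already
  \<open>p + r - 1/k\<^sup>2 \<in> M\<close>, where \<open>k\<close> is a constant that does not depend on \<open>r\<close>. Some \<open>r\<close> is available by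
  the archimedean property, and finitely many steps bring it to zero.
\<close>
theorem putinar_positivstellensatz:
  fixes M :: "('a::euclidean_space \<Rightarrow> real) set"
  assumes M: "quadratic_module M" "archimedean M"
    and p: "real_polynomial_function p"
    and pos: "\<And>x. (\<And>q. q \<in> M \<Longrightarrow> q x \<ge> 0) \<Longrightarrow> p x > 0"
  shows "p \<in> M"
proof -
  interpret quadratic_module M by fact
  have "(\<lambda>_. - 1) \<in> adjoin M {()} (\<lambda>_ x. - p x)" (is "_ \<in> ?M1")
  proof (rule ccontr)
    assume neg: "(\<lambda>_. - 1) \<notin> ?M1"
    have qm: "quadratic_module ?M1"
      using p by (intro quadratic_module_adjoin[OF M(1)]) (auto simp: real_polynomial_function_minus)
    have sub: "M \<subseteq> ?M1" by (auto intro: adjoin_base)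
    have neg_p: "(\<lambda>x. - p x) \<in> ?M1" using adjoin_generator[OF M(1), of "{()}" "()" "\<lambda>_ x. - p x"] by simp
    obtain S where S: "quadratic_module S" "?M1 \<subseteq> S" "(\<lambda>_. - 1) \<notin> S"
      "\<And>T. quadratic_module T \<Longrightarrow> S \<subseteq> T \<Longrightarrow> (\<lambda>_. - 1) \<notin> T \<Longrightarrow> T = S"
      using exists_maximal_proper_quadratic_module[OF qm neg] by metis
    have "archimedean S" using M(2) sub S(2) by (blast intro: archimedean_mono)
    from maximal_archimedean_has_point[OF S(1,3) this maximal_quadratic_module_total[OF S(1,3,4)]]
    obtain z where z: "\<And>q. q \<in> S \<Longrightarrow> q z \<ge> 0" by blast
    have "p z > 0" using z sub S(2) by (intro pos) blast
    moreover have "- p z \<ge> 0" using z[of "\<lambda>x. - p x"] neg_p S(2) by blast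
    ultimately show False by simp
  qed
  then obtain s m where s: "sos_poly s" and m: "m \<in> M" and "(\<lambda>_. - 1) = (\<lambda>x. m x + s x * - p x)"
    unfolding adjoin_def by auto
  then have "- 1 = m x + s x * - p x" for x by meson
  then have "s x * p x - 1 = m x" for x by (simp add: algebra_simps)
  with m have sp: "(\<lambda>x. s x * p x - 1) \<in> M" by simp
  have s_poly: "real_polynomial_function s" using s by (rule sos_poly_real_polynomial_function)
  obtain N where N: "(\<lambda>x. N - s x) \<in> M" using M(2) s_poly unfolding archimedean_def by blast
  have "real_polynomial_function (\<lambda>x. (s x)\<^sup>2 * p x)" using s_poly p by (intro poly_intros)
  then obtain K where K: "(\<lambda>x. K - (s x)\<^sup>2 * p x) \<in> M"
    using M(2) unfolding archimedean_def by blast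
  obtain r0 where r0: "(\<lambda>x. r0 - - p x) \<in> M"
    using M(2) real_polynomial_function_minus[OF p] unfolding archimedean_def by blast
  \<comment> \<open>Large enough for both \<open>2k - s\<close> and \<open>2k - 1 - s\<^sup>2 p\<close> to be in \<open>M\<close>.\<close>
  define k where "k = max 1 (max (N / 2) ((K + 1) / 2))"
  have k: "k \<ge> 1" "N \<le> 2 * k" "K \<le> 2 * k - 1" 
  proof -
    have "k \<ge> 1" "k \<ge> N / 2" "k \<ge> (K + 1) / 2" unfolding k_def le_max_iff_disj by simp_all
    then show "k \<ge> 1" "N \<le> 2 * k" "K \<le> 2 * k - 1" by simp_all
  qed
  have k1: "(\<lambda>x. 2 * k - s x) \<in> M" using add_const[of N "\<lambda>x. - s x" "2 * k"] N k by simp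
  have k2: "(\<lambda>x. (2 * k - 1) - (s x)\<^sup>2 * p x) \<in> M"
    using add_const[of K "\<lambda>x. - ((s x)\<^sup>2 * p x)" "2 * k - 1"] K k by simp
  have descent: "(\<lambda>x. (r - 1 / k\<^sup>2) + p x) \<in> M" if r: "r \<ge> 0" "(\<lambda>x. r + p x) \<in> M" for r
  proof -
    \<comment> \<open>The terms of degree one and two in \<open>s\<close> cancel, leaving \<open>k\<^sup>2 (r + p) - 1\<close>.\<close>
    have "(\<lambda>x. 1 / k\<^sup>2 * (((k - s x)\<^sup>2 * (r + p x) + 2 * k * (s x * p x - 1))
        + (r * (s x * (2 * k - s x)) + ((2 * k - 1) - (s x)\<^sup>2 * p x)))) \<in> M"
      using k r sp s_poly
      by (intro scale add k2 sos_mult[OF s k1] square_mult[OF r(2)] sp) (auto intro!: poly_intros)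
    moreover have "((k - s x)\<^sup>2 * (r + p x) + 2 * k * (s x * p x - 1))
        + (r * (s x * (2 * k - s x)) + ((2 * k - 1) - (s x)\<^sup>2 * p x)) = k\<^sup>2 * (r + p x) - 1" for x
      by (simp add: power2_eq_square algebra_simps)
    moreover have "1 / k\<^sup>2 * (k\<^sup>2 * (r + p x) - 1) = (r - 1 / k\<^sup>2) + p x" for x
      using k by (simp add: field_simps)
    ultimately show ?thesis by simp
  qed
  \<comment> \<open>The truncation at \<open>0\<close> keeps the constant in the range where the descent step applies.\<close>
  have iter: "(\<lambda>x. max 0 (r0 - real n * (1 / k\<^sup>2)) + p x) \<in> M" for n
  proof (induction n)
    case 0
    show ?case using add_const[of r0 p "max 0 r0"] r0 by simp
  next
    case (Suc n)
    show ?case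
      by (rule add_const[OF descent[OF _ Suc]]) (use k in \<open>auto simp: algebra_simps add_divide_distrib max_def\<close>)
  qed
  obtain n :: nat where "real n * (1 / k\<^sup>2) > r0"
    using reals_Archimedean3[of "1 / k\<^sup>2"] k by auto
  then show ?thesis using iter[of n] by simp
qed

lemma adjoin_singletonD:
  "p \<in> adjoin M {()} (\<lambda>_. q) \<Longrightarrow> \<exists>m\<in>M. \<exists>s. sos_poly s \<and> (\<forall>x. p x = m x + s x * q x)"
  unfolding adjoin_def by auto

section \<open>Polynomial strict supersolutions of the Bellman equation\<close>

text \<open>
  A vanishing minimum makes both of its arguments nonnegative. The first one says that \<open>v\<close> is a
  supersolution of the decrease condition for each disturbance separately; the second one says that
  \<open>v\<close> dominates the obstacle \<open>1 - pos_id (1 - hX j x)\<close> of each state constraint.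
\<close>
lemma bellman_supersolution:
  assumes "bellman_solution f D g nX hX v" "d \<in> D"
  shows "v (f x d) + g x * (1 - v x) \<le> v x"
proof -
  have "min (INF d\<in>D. ereal (v x - v (f x d) - g x * (1 - v x)))
          (ereal (v x - 1 + (MIN j\<in>{1..nX}. pos_id (1 - hX j x)))) = 0"
    using assms(1) unfolding bellman_solution_def by blast
  then have "0 \<le> (INF d\<in>D. ereal (v x - v (f x d) - g x * (1 - v x)))"
    by (metis min.cobounded1)
  also have "\<dots> \<le> ereal (v x - v (f x d) - g x * (1 - v x))"
    using assms(2) by (rule INF_lower)
  finally show ?thesis by simp
qed

lemma bellman_obstacle:
  assumes "bellman_solution f D g nX hX v" "j \<in> {1..nX}"
  shows "1 - pos_id (1 - hX j x) \<le> v x"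
proof -
  have "min (INF d\<in>D. ereal (v x - v (f x d) - g x * (1 - v x)))
          (ereal (v x - 1 + (MIN j\<in>{1..nX}. pos_id (1 - hX j x)))) = 0"
    using assms(1) unfolding bellman_solution_def by blast
  then have "ereal 0 \<le> ereal (v x - 1 + (MIN j\<in>{1..nX}. pos_id (1 - hX j x)))"
    by (metis min.cobounded2 zero_ereal_def)
  moreover have "(MIN j\<in>{1..nX}. pos_id (1 - hX j x)) \<le> pos_id (1 - hX j x)"
    using assms(2) by (intro Min_le) auto
  ultimately show ?thesis by simp
qed

text \<open>
  Raising \<open>v\<close> by a constant \<open>\<eta>\<close> leaves the difference \<open>v(x) - v(f(x, d))\<close> unchanged and adds
  \<open>\<eta> g(x)\<close> to the left-hand side of the decrease condition. On the compact set \<open>K\<close>, where \<open>g\<close> is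
  bounded away from zero, this is a uniform margin, which a sufficiently good polynomial
  approximation of \<open>v + \<eta>\<close> does not consume. The approximation has to be good on the one-step image
  of \<open>B\<close> as well, because \<open>f\<close> may lead out of \<open>B\<close>.
\<close>
lemma strict_polynomial_supersolution:
  fixes f :: "'a::euclidean_space \<Rightarrow> 'b::euclidean_space \<Rightarrow> 'a" and v g :: "'a \<Rightarrow> real"
  assumes B: "compact B" and D: "compact D" and K: "compact K" "K \<subseteq> B"
    and f: "continuous_on (B \<times> D) (\<lambda>(x, d). f x d)"
    and v: "continuous_on UNIV v" and g: "continuous_on UNIV g"
    and g_nonneg: "\<And>x. g x \<ge> 0" and g_pos: "\<And>x. x \<in> K \<Longrightarrow> g x > 0"
    and super: "\<And>x d. d \<in> D \<Longrightarrow> v (f x d) + g x * (1 - v x) \<le> v x"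
    and e: "e > 0"
  shows "\<exists>u. real_polynomial_function u \<and> (\<forall>x\<in>B. v x < u x \<and> u x < v x + e) \<and>
    (\<forall>x\<in>K. \<forall>d\<in>D. u x - u (f x d) - g x * (1 - u x) > 0)"
proof -
  let ?W = "B \<union> (\<lambda>(x, d). f x d) ` (B \<times> D)"
  have W: "compact ?W"
    using B D f by (intro compact_Un compact_continuous_image compact_Times)
  obtain \<gamma> where \<gamma>: "\<gamma> > 0" "\<And>x. x \<in> K \<Longrightarrow> \<gamma> \<le> g x"
  proof (cases "K = {}")
    case True
    then show ?thesis using that[of 1] by simp
  next
    case False
    then obtain y where "y \<in> K" "\<forall>x\<in>K. g y \<le> g x"
      using continuous_attains_inf[OF K(1)] continuous_on_subset[OF g] by (metis subset_UNIV)
    then show ?thesis using that[of "g y"] g_pos by blast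
  qed
  obtain G where G: "G \<ge> 0" "\<And>x. x \<in> K \<Longrightarrow> g x \<le> G"
  proof (cases "K = {}")
    case True
    then show ?thesis using that[of 0] by simp
  next
    case False
    then obtain y where "y \<in> K" "\<forall>x\<in>K. g x \<le> g y"
      using continuous_attains_sup[OF K(1)] continuous_on_subset[OF g] by (metis subset_UNIV)
    then show ?thesis using that[of "g y"] g_nonneg by blast
  qed
  define \<eta> where "\<eta> = e / 2"
  \<comment> \<open>An error \<open>\<delta>\<close> in \<open>u\<close> changes \<open>u(x) (1 + g(x)) - u(f(x, d)) - g(x)\<close> by at most
    \<open>\<delta> (2 + G)\<close>, which must stay below the margin \<open>\<eta> \<gamma>\<close>.\<close>
  define \<delta> where "\<delta> = min \<eta> (\<eta> * \<gamma> / (3 + G))"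
  have \<eta>: "\<eta> > 0" using e by (simp add: \<eta>_def)
  have \<delta>: "\<delta> > 0" "\<delta> \<le> \<eta>" using \<eta> \<gamma> G by (auto simp: \<delta>_def)
  have "\<delta> \<le> \<eta> * \<gamma> / (3 + G)" by (simp add: \<delta>_def)
  then have "\<delta> * (3 + G) \<le> \<eta> * \<gamma>" using G by (simp add: field_simps)
  with \<delta>(1) have \<delta>_small: "\<delta> * (2 + G) < \<eta> * \<gamma>" by (simp add: algebra_simps)
  have "continuous_on ?W (\<lambda>x. v x + \<eta>)"
    by (intro continuous_intros continuous_on_subset[OF v]) simp
  then obtain u where u: "real_polynomial_function u" "\<And>x. x \<in> ?W \<Longrightarrow> \<bar>v x + \<eta> - u x\<bar> < \<delta>"
    using Stone_Weierstrass_real_polynomial_function[OF W _ \<delta>(1)] by blast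
  have near: "v x + \<eta> - \<delta> < u x" "u x < v x + \<eta> + \<delta>" if "x \<in> ?W" for x
    using u(2)[OF that] by linarith+
  show ?thesis
  proof (intro exI[of _ u] conjI ballI u(1))
    fix x assume "x \<in> B"
    then show "v x < u x" "u x < v x + e"
      using near[of x] \<delta> by (auto simp: \<eta>_def)
  next
    fix x d assume x: "x \<in> K" and d: "d \<in> D"
    have "f x d \<in> ?W" using x d K(2) by force
    then have fxd: "u (f x d) < v (f x d) + \<eta> + \<delta>" by (rule near)
    have "(v x + \<eta> - \<delta>) * (1 + g x) \<le> u x * (1 + g x)"
      using near[of x] x K(2) g_nonneg[of x] by (intro mult_right_mono) auto
    moreover have "\<eta> * \<gamma> \<le> \<eta> * g x" using \<gamma> x \<eta> by simp
    moreover have "\<delta> * g x \<le> \<delta> * G" using G x \<delta> by simp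
    ultimately show "u x - u (f x d) - g x * (1 - u x) > 0"
      using fxd super[OF d, of x] \<delta>_small by (simp add: algebra_simps)
  qed
qed

section \<open>Certificates for the sum-of-squares program\<close>

lemma h0_eq_norm: "h0 x = (norm x)\<^sup>2"
  by (simp add: h0_def norm_vec_def L2_set_def sum_nonneg)

lemma compact_sqball: "compact (sqball r :: (real^'n) set)"
proof -
  have "bounded (sqball r :: (real^'n) set)"
    unfolding bounded_iff sqball_def
    by (rule exI[of _ "sqrt r"]) (auto intro: real_le_rsqrt)
  moreover have "closed (sqball r :: (real^'n) set)"
    unfolding sqball_def by (intro closed_Collect_le continuous_intros)
  ultimately show ?thesis by (simp add: compact_eq_bounded_closed)
qed

lemma real_polynomial_function_fst:
  "real_polynomial_function p \<Longrightarrow> real_polynomial_function (\<lambda>z. p (fst z))"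
  using real_polynomial_function_compose[OF polynomial_function_bounded_linear[OF bounded_linear_fst]]
  by (simp add: o_def)

lemma real_polynomial_function_snd:
  "real_polynomial_function p \<Longrightarrow> real_polynomial_function (\<lambda>z. p (snd z))"
  using real_polynomial_function_compose[OF polynomial_function_bounded_linear[OF bounded_linear_snd]]
  by (simp add: o_def)

lemma real_polynomial_function_h0: "real_polynomial_function h0"
  unfolding h0_def by (intro poly_intros real_polynomial_function.intros(1) bounded_linear_vec_nth) simp

text \<open>
  The module generated by the constraints is archimedean, since \<open>R - h0\<close> bounds the state and the
  ball constraint among the \<open>hD i\<close> bounds the disturbance; their sum is
  \<open>R + RD - \<parallel>(x, d)\<parallel>\<^sup>2\<close>.
\<close>
lemma sos_certificate_ball_times_disturbances:
  fixes p :: "(real^'n) \<times> (real^'m) \<Rightarrow> real" and hD :: "nat \<Rightarrow> real^'m \<Rightarrow> real"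
  assumes p: "real_polynomial_function p"
    and hinf: "real_polynomial_function hinf"
    and hD: "\<forall>i\<in>{1..md}. real_polynomial_function (hD i)"
    and ball: "i0 \<in> {1..md}" "\<And>d. hD i0 d = (norm d)\<^sup>2 - RD"
    and pos: "\<And>x d. x \<in> sqball R \<Longrightarrow> hinf x \<ge> 1 \<Longrightarrow> \<forall>i\<in>{1..md}. hD i d \<le> 0 \<Longrightarrow> p (x, d) > 0"
  shows "\<exists>s0 s1 s2 s3. sos_poly s0 \<and> sos_poly s1 \<and> sos_poly s2 \<and> (\<forall>i\<in>{1..md}. sos_poly (s3 i)) \<and>
    (\<forall>x d. p (x, d) = s0 (x, d) + s1 (x, d) * (R - h0 x) + s2 (x, d) * (hinf x - 1)
       - (\<Sum>i=1..md. s3 i (x, d) * hD i d))"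
proof -
  let ?q1 = "\<lambda>z. R - h0 (fst z)" and ?q2 = "\<lambda>z. hinf (fst z) - 1" and ?q3 = "\<lambda>i z. - hD i (snd z)"
  let ?M0 = "Collect sos_poly :: ((real^'n) \<times> (real^'m) \<Rightarrow> real) set"
  let ?M1 = "adjoin ?M0 {()} (\<lambda>_. ?q1)"
  let ?M2 = "adjoin ?M1 {()} (\<lambda>_. ?q2)"
  let ?M3 = "adjoin ?M2 {1..md} ?q3"
  have M1: "quadratic_module ?M1"
    by (intro quadratic_module_adjoin[OF quadratic_module_sos] poly_intros
        real_polynomial_function_fst real_polynomial_function_h0) simp
  have M2: "quadratic_module ?M2"
    by (intro quadratic_module_adjoin[OF M1] poly_intros real_polynomial_function_fst hinf) simp
  have M3: "quadratic_module ?M3"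
    by (intro quadratic_module_adjoin[OF M2] poly_intros real_polynomial_function_snd
        hD[rule_format]) simp_all
  have "?q1 \<in> ?M1" by (rule adjoin_generator[OF quadratic_module_sos]) simp_all
  then have q1: "?q1 \<in> ?M3" by (rule adjoin_base[OF adjoin_base])
  have "?q2 \<in> ?M2" by (rule adjoin_generator[OF M1]) simp_all
  then have q2: "?q2 \<in> ?M3" by (rule adjoin_base)
  have q3: "?q3 i \<in> ?M3" if "i \<in> {1..md}" for i
    using adjoin_generator[OF M2 _ that, of ?q3] by simp
  have "(\<lambda>z. ?q1 z + ?q3 i0 z) \<in> ?M3"
    by (intro quadratic_module.add[OF M3] q1 q3 ball(1))
  then have "(\<lambda>z. (R + RD) - (norm z)\<^sup>2) \<in> ?M3"
    by (simp add: ball(2) h0_eq_norm norm_prod_def algebra_simps)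
  then have arch: "archimedean ?M3" by (rule archimedean_if_ball[OF M3])
  have "p \<in> ?M3"
  proof (rule putinar_positivstellensatz[OF M3 arch p])
    fix z :: "(real^'n) \<times> (real^'m)" assume z: "\<And>q. q \<in> ?M3 \<Longrightarrow> q z \<ge> 0"
    show "p z > 0"
      using pos[of "fst z" "snd z"] z[OF q1] z[OF q2] z[OF q3]
      by (auto simp: sqball_def h0_eq_norm)
  qed
  then obtain m2 s3 where m2: "m2 \<in> ?M2" and s3: "\<forall>i\<in>{1..md}. sos_poly (s3 i)"
    and p_eq: "p = (\<lambda>z. m2 z + (\<Sum>i\<in>{1..md}. s3 i z * ?q3 i z))"
    unfolding adjoin_def[of ?M2] by blast
  from adjoin_singletonD[OF m2] obtain m1 s2
    where m1: "m1 \<in> ?M1" and s2: "sos_poly s2" "\<forall>z. m2 z = m1 z + s2 z * ?q2 z"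
    by blast
  from adjoin_singletonD[OF m1] obtain s0 s1
    where s1: "sos_poly s0" "sos_poly s1" "\<forall>z. m1 z = s0 z + s1 z * ?q1 z"
    by blast
  have "p (x, d) = s0 (x, d) + s1 (x, d) * (R - h0 x) + s2 (x, d) * (hinf x - 1)
       - (\<Sum>i=1..md. s3 i (x, d) * hD i d)" for x d
    by (simp add: p_eq s1 s2 sum_negf)
  with s1 s2 s3 show ?thesis by blast
qed

lemma sos_certificate_ball:
  fixes p :: "real^'n \<Rightarrow> real" and q :: "'i \<Rightarrow> real^'n \<Rightarrow> real"
  assumes p: "real_polynomial_function p"
    and I: "finite I" and q: "\<And>i. i \<in> I \<Longrightarrow> real_polynomial_function (q i)"
    and pos: "\<And>x. x \<in> sqball R \<Longrightarrow> \<forall>i\<in>I. q i x \<ge> 0 \<Longrightarrow> p x > 0"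
  shows "\<exists>s t r. sos_poly s \<and> sos_poly t \<and> (\<forall>i\<in>I. sos_poly (r i)) \<and>
    (\<forall>x. p x = s x + t x * (R - h0 x) + (\<Sum>i\<in>I. r i x * q i x))"
proof -
  let ?q1 = "\<lambda>x. R - h0 x"
  let ?M0 = "Collect sos_poly :: (real^'n \<Rightarrow> real) set"
  let ?M1 = "adjoin ?M0 {()} (\<lambda>_. ?q1)"
  let ?M2 = "adjoin ?M1 I q"
  have M1: "quadratic_module ?M1"
    by (intro quadratic_module_adjoin[OF quadratic_module_sos] poly_intros real_polynomial_function_h0) simp
  have M2: "quadratic_module ?M2"
    using I q by (intro quadratic_module_adjoin[OF M1])
  have "?q1 \<in> ?M1" by (rule adjoin_generator[OF quadratic_module_sos]) simp_all
  then have q1: "?q1 \<in> ?M2" by (rule adjoin_base)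
  have q2: "q i \<in> ?M2" if "i \<in> I" for i
    using adjoin_generator[OF M1 I that] .
  have arch: "archimedean ?M2"
    using q1 by (intro archimedean_if_ball[OF M2, of R]) (simp add: h0_eq_norm)
  have "p \<in> ?M2"
  proof (rule putinar_positivstellensatz[OF M2 arch p])
    fix x assume x: "\<And>q. q \<in> ?M2 \<Longrightarrow> q x \<ge> 0"
    show "p x > 0"
      using pos[of x] x[OF q1] x[OF q2] by (auto simp: sqball_def h0_eq_norm)
  qed
  then obtain m r where m: "m \<in> ?M1" and r: "\<forall>i\<in>I. sos_poly (r i)"
    and p_eq: "p = (\<lambda>x. m x + (\<Sum>i\<in>I. r i x * q i x))"
    unfolding adjoin_def[of ?M1] by blast
  from adjoin_singletonD[OF m] obtain s t
    where s: "sos_poly s" "sos_poly t" "\<forall>x. m x = s x + t x * ?q1 x"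
    by blast
  have "p x = s x + t x * (R - h0 x) + (\<Sum>i\<in>I. r i x * q i x)" for x
    by (simp add: p_eq s)
  with s r show ?thesis by blast
qed

lemma bchoice_triple:
  "\<forall>j\<in>A. \<exists>a b c. P j a b c \<Longrightarrow> \<exists>a b c. \<forall>j\<in>A. P j (a j) (b j) (c j)"
  by metis

text \<open>
  Each of the three polynomial identities of the program is a Putinar certificate for a polynomial
  that is strictly positive on the set cut out by the constraints on its right-hand side.
\<close>
lemma sos_solution_if_strict:
  fixes f :: "real^'n \<Rightarrow> real^'m \<Rightarrow> real^'n"
  assumes u: "u \<in> polys_upto k"
    and f: "\<forall>i. real_polynomial_function (\<lambda>(x, d). f x d $ i)"
    and hD: "\<forall>i\<in>{1..md}. real_polynomial_function (hD i)"
    and hX: "\<forall>j\<in>{1..nX}. real_polynomial_function (hX j)"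
    and g: "real_polynomial_function g" and hinf: "real_polynomial_function hinf"
    and ball: "i0 \<in> {1..md}" "\<And>d. hD i0 d = (norm d)\<^sup>2 - RD"
    and decrease: "\<And>x d. x \<in> sqball R \<Longrightarrow> hinf x \<ge> 1 \<Longrightarrow> \<forall>i\<in>{1..md}. hD i d \<le> 0 \<Longrightarrow>
      u x - u (f x d) - g x * (1 - u x) > 0"
    and outside: "\<And>x j. x \<in> sqball R \<Longrightarrow> j \<in> {1..nX} \<Longrightarrow> hX j x \<ge> 1 \<Longrightarrow> u x > 1"
    and inside: "\<And>x j. x \<in> sqball R \<Longrightarrow> j \<in> {1..nX} \<Longrightarrow> \<forall>l\<in>{1..nX}. hX l x \<le> 1 \<Longrightarrow> u x > hX j x"
  shows "\<exists>s0 s1 s2 s3 s4 s5 s6 s7 s8 s9.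
    sos_solution f md hD nX hX g R hinf k u s0 s1 s2 s3 s4 s5 s6 s7 s8 s9"
proof -
  have u_poly: "real_polynomial_function u"
    using u real_polynomial_function_iff_polys_upto by blast
  have "polynomial_function (\<lambda>z. f (fst z) (snd z))"
    unfolding polynomial_function_iff_Basis_inner
    using f by (auto simp: Basis_vec_def inner_axis case_prod_unfold)
  from real_polynomial_function_compose[OF this u_poly]
  have uf_poly: "real_polynomial_function (\<lambda>z. u (f (fst z) (snd z)))" by (simp add: o_def)
  let ?p = "\<lambda>z. u (fst z) - u (f (fst z) (snd z)) - g (fst z) * (1 - u (fst z))"
  have p_poly: "real_polynomial_function ?p"
    by (intro poly_intros uf_poly real_polynomial_function_fst u_poly g)
  have p_pos: "?p (x, d) > 0" if "x \<in> sqball R" "hinf x \<ge> 1" "\<forall>i\<in>{1..md}. hD i d \<le> 0" for x d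
    using decrease[OF that] by simp
  from sos_certificate_ball_times_disturbances[OF p_poly hinf hD ball p_pos] obtain s0 s1 s2 s3 where
    decrease_cert: "sos_poly s0" "sos_poly s1" "sos_poly s2" "\<forall>i\<in>{1..md}. sos_poly (s3 i)"
    "\<forall>x d. ?p (x, d) = s0 (x, d) + s1 (x, d) * (R - h0 x)
       + s2 (x, d) * (hinf x - 1) - (\<Sum>i=1..md. s3 i (x, d) * hD i d)"
    by blast
  have "\<forall>j\<in>{1..nX}. \<exists>s t r. sos_poly s \<and> sos_poly t \<and> sos_poly r \<and>
      (\<forall>x. u x - 1 = s x + t x * (R - h0 x) + r x * (hX j x - 1))"
  proof
    fix j assume j: "j \<in> {1..nX}"
    have "real_polynomial_function (\<lambda>x. u x - 1)" "real_polynomial_function (\<lambda>x. hX j x - 1)"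
      using u_poly hX j by (auto intro!: poly_intros)
    from sos_certificate_ball[where I = "{()}" and q = "\<lambda>_ x. hX j x - 1" and R = R, OF this(1)] this(2) outside[OF _ j]
    show "\<exists>s t r. sos_poly s \<and> sos_poly t \<and> sos_poly r \<and>
      (\<forall>x. u x - 1 = s x + t x * (R - h0 x) + r x * (hX j x - 1))" by auto
  qed
  from bchoice_triple[OF this] obtain s4 s5 s6 where outside_cert: "\<forall>j\<in>{1..nX}.
      sos_poly (s4 j) \<and> sos_poly (s5 j) \<and> sos_poly (s6 j) \<and>
      (\<forall>x. u x - 1 = s4 j x + s5 j x * (R - h0 x) + s6 j x * (hX j x - 1))"
    by (elim exE)
  have "\<forall>j\<in>{1..nX}. \<exists>s t r. sos_poly s \<and> sos_poly t \<and> (\<forall>l\<in>{1..nX}. sos_poly (r l)) \<and>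
      (\<forall>x. u x - hX j x = s x + t x * (R - h0 x) + (\<Sum>l=1..nX. r l x * (1 - hX l x)))"
  proof
    fix j assume j: "j \<in> {1..nX}"
    have "real_polynomial_function (\<lambda>x. u x - hX j x)"
      "\<And>l. l \<in> {1..nX} \<Longrightarrow> real_polynomial_function (\<lambda>x. 1 - hX l x)"
      using u_poly hX j by (auto intro!: poly_intros)
    from sos_certificate_ball[where I = "{1..nX}" and R = R, OF this(1) _ this(2)] inside[OF _ j]
    show "\<exists>s t r. sos_poly s \<and> sos_poly t \<and> (\<forall>l\<in>{1..nX}. sos_poly (r l)) \<and>
      (\<forall>x. u x - hX j x = s x + t x * (R - h0 x) + (\<Sum>l=1..nX. r l x * (1 - hX l x)))" by simp
  qed
  from bchoice_triple[OF this] obtain s7 s8 r where inside_cert: "\<forall>j\<in>{1..nX}.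
      sos_poly (s7 j) \<and> sos_poly (s8 j) \<and> (\<forall>l\<in>{1..nX}. sos_poly (r j l)) \<and>
      (\<forall>x. u x - hX j x = s7 j x + s8 j x * (R - h0 x) + (\<Sum>l=1..nX. r j l x * (1 - hX l x)))"
    by (elim exE)
  have "sos_solution f md hD nX hX g R hinf k u s0 s1 s2 s3 s4 s5 s6 s7 s8 (\<lambda>l j. r j l)"
    unfolding sos_solution_def using u decrease_cert outside_cert inside_cert by auto
  then show ?thesis by blast
qed

section \<open>Convergence from above\<close>

theorem lemma1:
  fixes f :: "real^'n \<Rightarrow> real^'m \<Rightarrow> real^'n"
    and md nX :: nat
    and hD :: "nat \<Rightarrow> real^'m \<Rightarrow> real"
    and hX :: "nat \<Rightarrow> real^'n \<Rightarrow> real"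
    and g hinf v :: "real^'n \<Rightarrow> real"
    and R :: real
    and D :: "(real^'m) set"
    and X Xinf :: "(real^'n) set"
  assumes f_poly: "\<forall>i. real_polynomial_function (\<lambda>(x, d). f x d $ i)"
    and hD_poly: "\<forall>i\<in>{1..md}. real_polynomial_function (hD i)"
    and D_eq: "D = {d. \<forall>i\<in>{1..md}. hD i d \<le> 0}"
    and D_compact: "compact D"
    and f_zero: "\<forall>d\<in>D. f 0 d = 0"
    and hX_poly: "\<forall>j\<in>{1..nX}. real_polynomial_function (hX j)"
    and hX_pos: "\<forall>j\<in>{1..nX}. \<forall>x. x \<noteq> 0 \<longrightarrow> hX j x > 0"
    and hX_zero: "\<forall>j\<in>{1..nX}. hX j 0 = 0"
    and X_eq: "X = {x. \<forall>j\<in>{1..nX}. hX j x < 1}"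
    and X_bounded: "bounded X"
    and X_open: "open X"
    and g_poly: "real_polynomial_function g"
    and g_nonneg: "\<forall>x. g x \<ge> 0"
    and g_zero: "\<forall>x. g x = 0 \<longleftrightarrow> x = 0"
    and v_sol: "bellman_solution f D g nX hX v"
    and stable: "unif_loc_exp_stable f D X"
    and R_pos: "R > 0"
    and reach: "reach_one f D X \<subseteq> sqball R"
    and hinf_poly: "real_polynomial_function hinf"
    and Xinf_eq: "Xinf = {x. hinf x < 1}"
    and Xinf_roa: "robust_roa f D X Xinf"
    and Xinf_zero: "0 \<in> interior Xinf"
    and D_ball: "\<exists>i\<in>{1..md}. \<exists>RD\<ge>0. \<forall>d. hD i d = (norm d)\<^sup>2 - RD"
  shows "\<exists>(k :: nat \<Rightarrow> nat) (u :: nat \<Rightarrow> real^'n \<Rightarrow> real).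
    strict_mono k \<and>
    (\<forall>i. \<exists>s0 s1 s2 s3 s4 s5 s6 s7 s8 s9.
      sos_solution f md hD nX hX g R hinf (k i) (u i) s0 s1 s2 s3 s4 s5 s6 s7 s8 s9) \<and>
    (\<forall>i. \<forall>x\<in>sqball R. v x \<le> u i x) \<and>
    uniform_limit (sqball R) u v sequentially"
proof -
  have poly_cont: "continuous_on S p" if "real_polynomial_function p"
    for S and p :: "real^'n \<Rightarrow> real"
    using that by (simp add: real_polynomial_function_eq continuous_on_polymonial_function)
  obtain i0 RD where ball: "i0 \<in> {1..md}" "\<And>d. hD i0 d = (norm d)\<^sup>2 - RD"
    using D_ball by blast
  let ?K = "{x \<in> sqball R. hinf x \<ge> 1}"
  have "?K = sqball R \<inter> {x. 1 \<le> hinf x}" by auto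
  then have K: "compact ?K"
    using poly_cont[OF hinf_poly] by (auto intro!: compact_Int_closed compact_sqball closed_Collect_le)
  have K_sub: "?K \<subseteq> sqball R" by auto
  have g_pos: "g x > 0" if "x \<in> ?K" for x
  proof -
    have "hinf 0 < 1" using Xinf_zero interior_subset Xinf_eq by blast
    with that have "x \<noteq> 0" by auto
    then show ?thesis using g_nonneg g_zero by (metis less_eq_real_def)
  qed
  have "polynomial_function (\<lambda>(x, d). f x d)"
    unfolding polynomial_function_iff_Basis_inner
    using f_poly by (auto simp: Basis_vec_def inner_axis case_prod_unfold)
  then have f_cont: "continuous_on (sqball R \<times> D) (\<lambda>(x, d). f x d)"
    by (rule continuous_on_polymonial_function)
  have v_cont: "continuous_on UNIV v" using v_sol unfolding bellman_solution_def by blast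
  have outside: "v x \<ge> 1" if "j \<in> {1..nX}" "hX j x \<ge> 1" for j x
    using bellman_obstacle[OF v_sol that(1), of x] that(2) by (simp add: pos_id_def split: if_splits)
  have inside: "v x \<ge> hX j x" if "j \<in> {1..nX}" "hX j x \<le> 1" for j x
    using bellman_obstacle[OF v_sol that(1), of x] that(2) by (simp add: pos_id_def)
  have ex_u: "\<exists>u K. (\<forall>x\<in>sqball R. v x \<le> u x \<and> u x < v x + inverse (real (Suc i))) \<and>
      (\<forall>k\<ge>K. \<exists>s0 s1 s2 s3 s4 s5 s6 s7 s8 s9.
        sos_solution f md hD nX hX g R hinf k u s0 s1 s2 s3 s4 s5 s6 s7 s8 s9)" for i
  proof -
    have "\<exists>u. real_polynomial_function u \<and>
        (\<forall>x\<in>sqball R. v x < u x \<and> u x < v x + inverse (real (Suc i))) \<and>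
        (\<forall>x\<in>?K. \<forall>d\<in>D. u x - u (f x d) - g x * (1 - u x) > 0)"
    proof (rule strict_polynomial_supersolution[OF compact_sqball D_compact K K_sub f_cont v_cont
          poly_cont[OF g_poly]])
      show "g x \<ge> 0" for x using g_nonneg by blast
      show "g x > 0" if "x \<in> ?K" for x using that by (rule g_pos)
      show "v (f x d) + g x * (1 - v x) \<le> v x" if "d \<in> D" for x d
        using v_sol that by (rule bellman_supersolution)
      show "inverse (real (Suc i)) > 0" by simp
    qed
    then obtain u where u: "real_polynomial_function u"
      "\<forall>x\<in>sqball R. v x < u x \<and> u x < v x + inverse (real (Suc i))"
      "\<forall>x\<in>?K. \<forall>d\<in>D. u x - u (f x d) - g x * (1 - u x) > 0"
      by (elim exE conjE)
    obtain K where "u \<in> polys_upto K"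
      using u(1) real_polynomial_function_iff_polys_upto by blast
    then have degree: "u \<in> polys_upto k" if "k \<ge> K" for k
      using that by (rule polys_upto_mono)
    have "\<exists>s0 s1 s2 s3 s4 s5 s6 s7 s8 s9.
        sos_solution f md hD nX hX g R hinf k u s0 s1 s2 s3 s4 s5 s6 s7 s8 s9" if "k \<ge> K" for k
    proof (rule sos_solution_if_strict[OF degree[OF that] f_poly hD_poly hX_poly g_poly hinf_poly ball])
      fix x d assume "x \<in> sqball R" "hinf x \<ge> 1" "\<forall>i\<in>{1..md}. hD i d \<le> 0"
      then show "u x - u (f x d) - g x * (1 - u x) > 0" using u(3) D_eq by blast
    next
      fix x j assume "x \<in> sqball R" "j \<in> {1..nX}" "hX j x \<ge> 1"
      then show "u x > 1" using u(2) outside[of j x] by fastforce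
    next
      fix x j assume "x \<in> sqball R" "j \<in> {1..nX}" "\<forall>l\<in>{1..nX}. hX l x \<le> 1"
      then show "u x > hX j x" using u(2) inside[of j x] by force
    qed
    then show ?thesis using u(2) by (intro exI[of _ u] exI[of _ K]) (auto intro: less_imp_le)
  qed
  then obtain u K where
    u_bounds: "\<And>i x. x \<in> sqball R \<Longrightarrow> v x \<le> u i x \<and> u i x < v x + inverse (real (Suc i))"
    and u_sos: "\<And>i k. k \<ge> K i \<Longrightarrow> \<exists>s0 s1 s2 s3 s4 s5 s6 s7 s8 s9.
        sos_solution f md hD nX hX g R hinf k (u i) s0 s1 s2 s3 s4 s5 s6 s7 s8 s9"
    by metis
  \<comment> \<open>The certificates for \<open>u i\<close> serve every degree bound from \<open>K i\<close> on, so the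
    bounds may be enlarged to a strictly increasing sequence.\<close>
  define k where "k i = (\<Sum>j\<le>i. K j) + i" for i
  have "strict_mono k" by (simp add: strict_mono_Suc_iff k_def)
  moreover have "k i \<ge> K i" for i
    using member_le_sum[of i "{..i}" K] by (simp add: k_def)
  moreover have "uniform_limit (sqball R) u v sequentially"
  proof (rule uniform_limitI)
    fix e :: real assume "e > 0"
    then have "\<forall>\<^sub>F i in sequentially. inverse (real (Suc i)) < e"
      using order_tendstoD(2)[OF LIMSEQ_inverse_real_of_nat] by blast
    then show "\<forall>\<^sub>F i in sequentially. \<forall>x\<in>sqball R. dist (u i x) (v x) < e"
    proof (rule eventually_mono, intro ballI)
      fix i and x :: "real^'n" assume "inverse (real (Suc i)) < e" "x \<in> sqball R"
      then show "dist (u i x) (v x) < e" using u_bounds[of x i] by (simp add: dist_real_def)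
    qed
  qed
  ultimately show ?thesis using u_bounds u_sos by blast
qed

end
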